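(* Given a directed acyclic graph $G$ with $n$ vertices and $m$ arcs, and $k$ pairs of vertices $(u_1,v_1),\dots,(u_k,v_k)$ of $G$, all junctions of all the $k$ given pairs can be found in $O(n(m+k))$ time. The space used is $O(m)$ if the junctions are printed out during the execution, and $O(nk+m)$ if all junctions of the $k$ given pairs are stored.
   Context: All paths are directed, and a single vertex counts as a (trivial) directed path. For distinct vertices $u,v$ of a directed acyclic graph $G$, a vertex $s\in G$ is a junction of $u,v$ if there are internally disjoint directed paths $P$ from $s$ to $u$ and $Q$ from $s$ to $v$ in $G$, where internally disjoint means that $s$ is the only vertex common to $P$ and $Q$. In particular, if $u$ is a proper ancestor of $v$, then $u$ is a junction of $u,v$. By convention no vertex is a junction of a pair $u,u$. *)

theory Defs
  imports "Graph_Theory.Pair_Digraph"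
begin

section \<open>Junctions in directed acyclic graphs\<close>

definition dag :: "('a, 'b) pre_digraph \<Rightarrow> bool" where
  "dag G \<longleftrightarrow> digraph G \<and> (\<nexists>p. pre_digraph.cycle G p)"

definition (in pre_digraph) internally_disjoint :: "'a \<Rightarrow> 'b awalk \<Rightarrow> 'b awalk \<Rightarrow> bool" where
  "internally_disjoint s p q \<longleftrightarrow> set (awalk_verts s p) \<inter> set (awalk_verts s q) = {s}"

definition (in pre_digraph) junction :: "'a \<Rightarrow> 'a \<Rightarrow> 'a \<Rightarrow> bool" where
  "junction u v s \<longleftrightarrow>
     u \<noteq> v \<and> (\<exists>p q. apath s p u \<and> apath s q v \<and> internally_disjoint s p q)"


section \<open>A word RAM\<close>

text \<open>
  The machine has a read-only random-access input, a write-only output sequence, and a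
  random-access working memory. Programs are structured, but every elementary operation
  costs one step. Expressions evaluate to natural numbers; \<open>Cell a\<close> and \<open>Input a\<close> read
  the working memory and the input at the address given by the value of \<open>a\<close>, so nesting
  gives indirect addressing. There are no program variables besides the memory cells.
\<close>

datatype expr =
    Const nat
  | Cell expr
  | Input expr
  | Plus expr expr
  | Minus expr expr
  | Times expr expr

datatype prog =
    Skip
  | Store expr expr        \<comment> \<open>address, value\<close>
  | Output expr
  | Seq prog prog
  | If expr prog prog      \<comment> \<open>a nonzero value counts as true\<close>
  | While expr prog

type_synonym memory = "nat \<Rightarrow> nat"
type_synonym config = "memory \<times> nat list"   \<comment> \<open>working memory, output written so far\<close>

primrec val :: "nat list \<Rightarrow> memory \<Rightarrow> expr \<Rightarrow> nat" where
  "val inp mem (Const c) = c"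
| "val inp mem (Cell a) = mem (val inp mem a)"
| "val inp mem (Input a) = inp ! val inp mem a"
| "val inp mem (Plus a b) = val inp mem a + val inp mem b"
| "val inp mem (Minus a b) = val inp mem a - val inp mem b"
| "val inp mem (Times a b) = val inp mem a * val inp mem b"

primrec cost :: "expr \<Rightarrow> nat" where
  "cost (Const c) = 1"
| "cost (Cell a) = cost a + 1"
| "cost (Input a) = cost a + 1"
| "cost (Plus a b) = cost a + cost b + 1"
| "cost (Minus a b) = cost a + cost b + 1"
| "cost (Times a b) = cost a + cost b + 1"

text \<open>
  \<open>fits W S inp mem e\<close>: the evaluation of \<open>e\<close> produces only words, i.e. numbers below \<open>W\<close>,
  and it accesses only the first \<open>S\<close> cells of the working memory and existing input positions.
\<close>

primrec fits :: "nat \<Rightarrow> nat \<Rightarrow> nat list \<Rightarrow> memory \<Rightarrow> expr \<Rightarrow> bool" where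
  "fits W S inp mem (Const c) \<longleftrightarrow> c < W"
| "fits W S inp mem (Cell a) \<longleftrightarrow>
     fits W S inp mem a \<and> val inp mem a < S \<and> val inp mem (Cell a) < W"
| "fits W S inp mem (Input a) \<longleftrightarrow>
     fits W S inp mem a \<and> val inp mem a < length inp \<and> val inp mem (Input a) < W"
| "fits W S inp mem (Plus a b) \<longleftrightarrow>
     fits W S inp mem a \<and> fits W S inp mem b \<and> val inp mem (Plus a b) < W"
| "fits W S inp mem (Minus a b) \<longleftrightarrow>
     fits W S inp mem a \<and> fits W S inp mem b \<and> val inp mem (Minus a b) < W"
| "fits W S inp mem (Times a b) \<longleftrightarrow>
     fits W S inp mem a \<and> fits W S inp mem b \<and> val inp mem (Times a b) < W"

text \<open>
  \<open>exec W S inp P c t c'\<close>: started in configuration \<open>c\<close>, the program \<open>P\<close> halts after \<open>t\<close> steps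
  in configuration \<open>c'\<close>, all numbers occurring on the way being below \<open>W\<close> and all accessed
  memory cells being among the first \<open>S\<close> ones. A run that would violate a limit is stuck, so
  \<open>S\<close> bounds the working space, and \<open>W\<close> the word size by \<open>log\<^sub>2 W\<close> bits.
\<close>

inductive exec :: "nat \<Rightarrow> nat \<Rightarrow> nat list \<Rightarrow> prog \<Rightarrow> config \<Rightarrow> nat \<Rightarrow> config \<Rightarrow> bool"
  for W S :: nat and inp :: "nat list" where
  Skip: "exec W S inp Skip c 1 c"
| Store: "fits W S inp mem a \<Longrightarrow> fits W S inp mem e \<Longrightarrow> val inp mem a < S \<Longrightarrow>
    exec W S inp (Store a e) (mem, out) (cost a + cost e + 1)
      (mem(val inp mem a := val inp mem e), out)"
| Output: "fits W S inp mem e \<Longrightarrow>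
    exec W S inp (Output e) (mem, out) (cost e + 1) (mem, out @ [val inp mem e])"
| Seq: "exec W S inp P c t c' \<Longrightarrow> exec W S inp Q c' t' c'' \<Longrightarrow>
    exec W S inp (Seq P Q) c (t + t') c''"
| IfTrue: "fits W S inp (fst c) e \<Longrightarrow> val inp (fst c) e \<noteq> 0 \<Longrightarrow> exec W S inp P c t c' \<Longrightarrow>
    exec W S inp (If e P Q) c (cost e + 1 + t) c'"
| IfFalse: "fits W S inp (fst c) e \<Longrightarrow> val inp (fst c) e = 0 \<Longrightarrow> exec W S inp Q c t c' \<Longrightarrow>
    exec W S inp (If e P Q) c (cost e + 1 + t) c'"
| WhileTrue: "fits W S inp (fst c) e \<Longrightarrow> val inp (fst c) e \<noteq> 0 \<Longrightarrow> exec W S inp P c t c' \<Longrightarrow>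
    exec W S inp (While e P) c' t' c'' \<Longrightarrow>
    exec W S inp (While e P) c (cost e + 1 + t + t') c''"
| WhileFalse: "fits W S inp (fst c) e \<Longrightarrow> val inp (fst c) e = 0 \<Longrightarrow>
    exec W S inp (While e P) c (cost e + 1) c"

text \<open>Programs are deterministic, and the limits do not influence the outcome of a run.\<close>

lemma exec_deterministic:
  assumes "exec W S inp P c t c'" and "exec W' S' inp P c u d"
  shows "u = t \<and> d = c'"
  using assms
proof (induction arbitrary: u d rule: exec.induct)
  case (Skip c)
  then show ?case by (auto elim: exec.cases)
next
  case (Store mem a e out)
  from Store.prems show ?case by (cases rule: exec.cases) auto
next
  case (Output mem e out)
  from Output.prems show ?case by (cases rule: exec.cases) auto
next
  case (Seq P c t c' Q t' c'')
  from Seq.prems show ?case by (cases rule: exec.cases) (use Seq.IH in blast)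
next
  case (IfTrue c e P t c' Q)
  from IfTrue.prems show ?case by (cases rule: exec.cases) (use IfTrue in auto)
next
  case (IfFalse c e Q t c' P)
  from IfFalse.prems show ?case by (cases rule: exec.cases) (use IfFalse in auto)
next
  case (WhileTrue c e P t c' t' c'')
  from WhileTrue.prems show ?case by (cases rule: exec.cases) (use WhileTrue in blast)+
next
  case (WhileFalse c e P)
  from WhileFalse.prems show ?case by (cases rule: exec.cases) (use WhileFalse in auto)
qed

definition initial :: config where
  "initial = (\<lambda>_. 0, [])"


section \<open>The problem of finding all junctions of given pairs\<close>

text \<open>
  An instance consists of a directed acyclic graph with vertices \<open>0, \<dots>, n - 1\<close>, its arcs
  listed in an arbitrary order, and a list of pairs of vertices.
\<close>

definition is_instance ::
    "nat pair_pre_digraph \<Rightarrow> nat \<Rightarrow> (nat \<times> nat) list \<Rightarrow> (nat \<times> nat) list \<Rightarrow> bool" where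
  "is_instance G n es ps \<longleftrightarrow>
     dag (with_proj G) \<and> pverts G = {0..<n} \<and>
     distinct es \<and> set es = parcs G \<and>
     set ps \<subseteq> pverts G \<times> pverts G"

definition flatten :: "(nat \<times> nat) list \<Rightarrow> nat list" where
  "flatten xs = concat (map (\<lambda>(a, b). [a, b]) xs)"

definition input :: "nat \<Rightarrow> (nat \<times> nat) list \<Rightarrow> (nat \<times> nat) list \<Rightarrow> nat list" where
  "input n es ps = [n, length es, length ps] @ flatten es @ flatten ps"

definition junctions_of :: "nat pair_pre_digraph \<Rightarrow> nat \<times> nat \<Rightarrow> nat set" where
  "junctions_of G = (\<lambda>(u, v). {s. pre_digraph.junction (with_proj G) u v s})"

text \<open>
  Printing: the output lists, in any order and without repetition, the pairs \<open>(i, s)\<close> such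
  that \<open>s\<close> is a junction of the \<open>i\<close>-th given pair.
\<close>

definition prints_junctions ::
    "nat pair_pre_digraph \<Rightarrow> (nat \<times> nat) list \<Rightarrow> config \<Rightarrow> bool" where
  "prints_junctions G ps c \<longleftrightarrow>
     (\<exists>xs. snd c = flatten xs \<and> distinct xs \<and>
           set xs = {(i, s). i < length ps \<and> s \<in> junctions_of G (ps ! i)})"

text \<open>
  Storing: cell \<open>0\<close> contains the address of a table whose \<open>i\<close>-th entry consists of two words,
  the start address and the length of an array that lists the junctions of the \<open>i\<close>-th given
  pair without repetition. The table and the arrays lie within the first \<open>S\<close> cells.
\<close>

definition stores_junctions ::
    "nat \<Rightarrow> nat pair_pre_digraph \<Rightarrow> (nat \<times> nat) list \<Rightarrow> config \<Rightarrow> bool" where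
  "stores_junctions S G ps c \<longleftrightarrow>
     (let mem = fst c; table = mem 0 in
        table + 2 * length ps \<le> S \<and>
        (\<forall>i < length ps.
           let start = mem (table + 2 * i);
               len = mem (table + 2 * i + 1);
               js = map mem [start..<start + len]
           in start + len \<le> S \<and> distinct js \<and> set js = junctions_of G (ps ! i)))"

end

theory Submission
  imports Defs
begin

text \<open>
  Fix a source \<open>s\<close>. Labelling every vertex \<open>x\<close> that is reachable from \<open>s\<close> with the child of \<open>s\<close>
  above \<open>x\<close> in the dominator tree makes \<open>s\<close> a junction of \<open>u\<close> and \<open>v\<close> iff both are reachable and
  have different labels. One pass over the arcs, sorted by the height of their heads, computes the
  labels: a vertex inherits the label of its reachable predecessors if they agree on one other
  than \<open>s\<close>, and is labelled with itself otherwise.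

  Space \<open>O(m)\<close> is an issue because \<open>n\<close> may exceed \<open>m\<close>, and \<open>k\<close> may too. Vertices that occur in
  arcs are therefore represented by positions in the list of arc ends; all others are represented
  by one dummy, since they belong to no junction. The representatives are found by scanning the
  list once per vertex, in time \<open>O(nm)\<close>. For the given pairs this is done in batches of \<open>m\<close> pairs,
  each of which costs \<open>O(nm)\<close> in total, so the at most \<open>k/m + 1\<close> batches take time \<open>O(n(m + k))\<close>.
\<close>

section \<open>Heights and labels\<close>

text \<open>The time bound permits \<open>n\<close> scans over all arcs. Hence heights come from
  repeated relaxation and the arc order from one scan per height, with no queues or adjacency lists.
  The order does not depend on the source, so it is computed once and serves all \<open>n\<close>
  passes. Sorting by the height of the head makes every processed arc start strictly below the head
  now being labelled, so writing that label leaves the tails of the processed arcs untouched;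
  correctness thus becomes one invariant, \<open>labelling\<close>, for the set of arcs seen so far.
  Dominator trees never enter the proof: it suffices that a label lies on every walk from the
  source, and that different labels allow disjoint walks to be built. Labels are numbers of
  vertices, but they are stored at addresses of representatives; the dummy only ever receives label
  0, so it reads as unreachable. Printing and storing share one algorithm with a parameter
  \<open>emit\<close>; the two sides write to disjoint sets of cells. A graph without arcs is
  treated apart, since batches of \<open>m\<close> pairs would then make no progress.\<close>

context fin_digraph
begin

text \<open>The longest-walk level, not a distance: it strictly grows along arcs. \<open>Max\<close>
  is meaningful only in the acyclic context below, where every walk is a path and the set of lengths
  is finite.\<close>

definition height :: "'a \<Rightarrow> nat" where
  "height v = Max {length p | p u. awalk u p v}"

context
  assumes acyclic: "\<nexists>p. cycle p"
begin

lemma acyclic_awalk_apath: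
  assumes "awalk u p v" shows "apath u p v"
proof (rule ccontr)
  assume "\<not> apath u p v"
  with assms have "\<not> distinct (awalk_verts u p)" by (simp add: apath_def)
  then obtain q r s w where "r \<noteq> []" "awalk w r w"
    using awalk_not_distinct_decomp[OF assms] by blast
  then have "closed_w r" by (auto simp: closed_w_def)
  then show False using closed_w_imp_cycle acyclic by blast
qed

lemma awalk_length_less: "awalk u p v \<Longrightarrow> length p < card (verts G)"
  using acyclic_awalk_apath length_apath_less by blast

lemma finite_lengths: "finite {length p | p u. awalk u p v}"
  by (rule finite_subset[of _ "{..<card (verts G)}"]) (auto intro: awalk_length_less)

lemma length_le_height: "awalk u p v \<Longrightarrow> length p \<le> height v"
  unfolding height_def by (intro Max_ge finite_lengths) auto

lemma height_attained:
  assumes "v \<in> verts G" obtains u p where "awalk u p v" "length p = height v"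
proof -
  have "awalk v [] v" using assms by (simp add: awalk_Nil_iff)
  then have "height v \<in> {length p | p u. awalk u p v}"
    unfolding height_def by (intro Max_in finite_lengths) blast
  then show thesis using that by auto
qed

lemma height_less: "v \<in> verts G \<Longrightarrow> height v < card (verts G)"
  by (metis awalk_length_less height_attained)

lemma height_arc:
  assumes "e \<in> arcs G" shows "height (tail G e) < height (head G e)"
proof -
  obtain u p where p: "awalk u p (tail G e)" "length p = height (tail G e)"
    using height_attained assms by (metis tail_in_verts)
  from p(1) assms have "awalk u (p @ [e]) (head G e)"
    by (intro awalk_appendI[OF _ arc_implies_awalk])
  from length_le_height[OF this] p(2) show ?thesis by simp
qed

text \<open>Cut the last arc off a longest walk. This is the progress argument for relaxation: every
  positive height is forced by some arc.\<close>

lemma height_pred: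
  assumes "v \<in> verts G" "height v \<noteq> 0"
  obtains e where "e \<in> arcs G" "head G e = v" "height v = Suc (height (tail G e))"
proof -
  obtain u p where p: "awalk u p v" "length p = height v"
    using height_attained assms(1) by blast
  then obtain q e where q: "p = q @ [e]"
    using assms(2) by (metis length_0_conv rev_exhaust)
  with p(1) have e: "awalk u q (tail G e)" "e \<in> arcs G" "head G e = v"
    by (auto simp: awalk_Cons_iff awalk_Nil_iff)
  have "height v \<le> Suc (height (tail G e))"
    using length_le_height[OF e(1)] p(2) q by simp
  with height_arc[OF e(2)] e that show thesis by fastforce
qed

end

end

section \<open>Labels computed arc by arc\<close>

text \<open>In labels, \<open>0\<close> stands for unreachable and \<open>Suc c\<close> for the vertex \<open>c\<close>.\<close>

definition merge :: "nat \<Rightarrow> nat \<Rightarrow> nat set \<Rightarrow> nat" where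
  "merge s y R = (if R = {} then 0 else if \<exists>c. R = {c} \<and> c \<noteq> Suc s then the_elem R else Suc y)"

definition pred_labels :: "(nat \<times> nat) set \<Rightarrow> (nat \<Rightarrow> nat) \<Rightarrow> nat \<Rightarrow> nat set" where
  "pred_labels E L y = {L x | x. (x, y) \<in> E \<and> L x \<noteq> 0}"

text \<open>The last clause makes the recursion maintainable: a label names a vertex that is not
  above its bearer, and reachable vertices other than \<open>s\<close> lie strictly above
  \<open>s\<close>. So \<open>Suc y\<close> cannot yet be the label of anything below
  \<open>y\<close>.\<close>

definition labelling :: "(nat \<Rightarrow> nat) \<Rightarrow> nat \<Rightarrow> (nat \<times> nat) set \<Rightarrow> (nat \<Rightarrow> nat) \<Rightarrow> bool" where
  "labelling h s E L \<longleftrightarrow> L s = Suc s \<and>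
     (\<forall>y. y \<noteq> s \<longrightarrow> L y = merge s y (pred_labels E L y)) \<and>
     (\<forall>v. L v \<noteq> 0 \<longrightarrow> h (L v - 1) \<le> h v \<and> (v = s \<or> h s < h v))"

lemma labelling_init: "labelling h s {} ((\<lambda>_. 0)(s := Suc s))"
  by (auto simp: labelling_def merge_def pred_labels_def)

text \<open>The incremental form of \<open>merge\<close>: the current label of \<open>y\<close>
  summarises all earlier predecessors, so no set of labels has to be stored.\<close>

definition label_step :: "nat \<Rightarrow> nat \<Rightarrow> nat \<Rightarrow> (nat \<Rightarrow> nat) \<Rightarrow> (nat \<Rightarrow> nat)" where
  "label_step s x y L =
     (if L x = 0 then L
      else if L x = Suc s \<or> L y \<noteq> 0 \<and> L y \<noteq> L x then L(y := Suc y)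
      else L(y := L x))"

lemma merge_cases: "c \<in> R \<Longrightarrow> merge s y R = Suc y \<or> merge s y R = c"
  by (auto simp: merge_def)

text \<open>The old value suffices because \<open>Suc y\<close> is not a predecessor label: as an
  old value it can only record a disagreement or an arc from \<open>s\<close>, and no further label
  can agree with it.\<close>

lemma merge_insert:
  assumes "c \<noteq> 0" "Suc y \<notin> insert c R" "0 \<notin> R"
  shows "merge s y (insert c R) =
    (if c = Suc s \<or> merge s y R \<noteq> 0 \<and> merge s y R \<noteq> c then Suc y else c)"
proof (cases "\<exists>d. R = {d}")
  case True
  then show ?thesis using assms by (auto simp: merge_def)
next
  case False
  then show ?thesis using assms by (cases "R = {}") (auto simp: merge_def)
qed

lemma labelling_step:
  assumes L: "labelling h s E L"
    and h: "h x < h y" "\<And>a b. (a, b) \<in> E \<Longrightarrow> h a < h b" "\<And>a b. (a, b) \<in> E \<Longrightarrow> h b \<le> h y"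
  shows "labelling h s (insert (x, y) E) (label_step s x y L)"
proof (cases "L x = 0")
  case True
  then have "pred_labels (insert (x, y) E) L z = pred_labels E L z" for z
    by (auto simp: pred_labels_def)
  with L True show ?thesis by (simp add: labelling_def label_step_def)
next
  case False
  define L' where "L' = label_step s x y L"
  have "x = s \<or> h s < h x" using L False unfolding labelling_def by metis
  with h(1) have ys: "y \<noteq> s" and hs: "h s < h y" by auto
  have same: "L' z = L z" if "z \<noteq> y" for z
    using that by (auto simp: L'_def label_step_def)
  \<comment> \<open>Tails lie below heads and no head seen so far is above \<open>y\<close>, so
    \<open>y\<close> is not a tail; relabelling \<open>y\<close> changes no predecessor set.\<close>
  have tails: "a \<noteq> y" if "(a, b) \<in> insert (x, y) E" for a b
    using that h by fastforce
  have preds: "pred_labels (insert (x, y) E) L' z =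
      (if z = y then insert (L x) (pred_labels E L y) else pred_labels E L z)" for z
  proof -
    have "pred_labels (insert (x, y) E) L' z = pred_labels (insert (x, y) E) L z"
      unfolding pred_labels_def by (intro Collect_cong ex_cong1) (metis same tails)
    also have "\<dots> = (if z = y then insert (L x) (pred_labels E L y) else pred_labels E L z)"
      using False by (auto simp: pred_labels_def)
    finally show ?thesis .
  qed
  \<comment> \<open>A bearer of the label \<open>Suc y\<close> cannot be lower than
    \<open>y\<close>, by the level clause of the invariant.\<close>
  have fresh: "Suc y \<noteq> L a" if "h a < h y" for a
  proof
    assume "Suc y = L a"
    then have "h (L a - 1) \<le> h a" using L unfolding labelling_def by (metis nat.simps(3))
    then show False using that \<open>Suc y = L a\<close> by (metis diff_Suc_1 not_le)
  qed
  have "L' y = merge s y (insert (L x) (pred_labels E L y))"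
  proof (subst merge_insert)
    show "Suc y \<notin> insert (L x) (pred_labels E L y)"
      using fresh h by (fastforce simp: pred_labels_def)
  next
    have "merge s y (pred_labels E L y) = L y"
      using L ys unfolding labelling_def by metis
    then show "L' y = (if L x = Suc s \<or> merge s y (pred_labels E L y) \<noteq> 0 \<and>
        merge s y (pred_labels E L y) \<noteq> L x then Suc y else L x)"
      using False by (simp add: L'_def label_step_def)
  qed (use False in \<open>auto simp: pred_labels_def\<close>)
  moreover have "h (L' y - 1) \<le> h y"
  proof -
    have "L' y = Suc y \<or> L' y = L x"
      using False by (auto simp: L'_def label_step_def)
    moreover have "h (L x - 1) \<le> h x" using L False unfolding labelling_def by metis
    ultimately show ?thesis using h(1) by auto
  qed
  ultimately have y: "L' y = merge s y (insert (L x) (pred_labels E L y))" "h (L' y - 1) \<le> h y" .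
  have "labelling h s (insert (x, y) E) L'"
    unfolding labelling_def preds
  proof (intro conjI allI impI)
    show "L' s = Suc s" using L ys same[of s] by (simp add: labelling_def)
  next
    fix z assume "z \<noteq> s"
    then have "L z = merge s z (pred_labels E L z)" using L by (simp add: labelling_def)
    then show "L' z = merge s z (if z = y then insert (L x) (pred_labels E L y) else pred_labels E L z)"
      using y(1) same[of z] by simp
  next
    fix v assume "L' v \<noteq> 0"
    then have "h (L' v - 1) \<le> h v \<and> (v = s \<or> h s < h v)"
    proof (cases "v = y")
      case False
      then show ?thesis using L \<open>L' v \<noteq> 0\<close> same[OF False] by (simp add: labelling_def)
    qed (use y(2) hs in simp)
    then show "h (L' v - 1) \<le> h v" "v = s \<or> h s < h v" by auto
  qed
  then show ?thesis by (simp add: L'_def)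
qed

lemma labelling_source: "labelling h s E L \<Longrightarrow> L s = Suc s"
  by (simp add: labelling_def)

lemma labelling_merge:
  "labelling h s E L \<Longrightarrow> y \<noteq> s \<Longrightarrow> L y = merge s y (pred_labels E L y)"
  by (simp add: labelling_def)

lemma labelling_level:
  "labelling h s E L \<Longrightarrow> L v \<noteq> 0 \<Longrightarrow> h (L v - 1) \<le> h v \<and> (v = s \<or> h s < h v)"
  by (simp add: labelling_def)

text \<open>Away from \<open>s\<close>, \<open>merge\<close> never yields \<open>Suc s\<close>: the
  singleton \<open>{Suc s}\<close> is excluded from inheritance, and a vertex's own label differs
  from it.\<close>

lemma labelling_eq_source:
  assumes "labelling h s E L" "L x = Suc s" shows "x = s"
proof (rule ccontr)
  assume "x \<noteq> s"
  with assms have "merge s x (pred_labels E L x) = Suc s" by (simp add: labelling_merge[symmetric])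
  with \<open>x \<noteq> s\<close> show False by (auto simp: merge_def split: if_splits)
qed

section \<open>From labels to disjoint walks and junctions\<close>

locale levelled_digraph = wf_digraph "with_proj G" for G :: "nat pair_pre_digraph" +
  fixes h :: "nat \<Rightarrow> nat"
  assumes level_arc: "(x, y) \<in> parcs G \<Longrightarrow> h x < h y"
begin

lemma set_awalk_verts_snoc:
  assumes "awalk s p x" "(x, y) \<in> parcs G"
  shows "awalk s (p @ [(x, y)]) y \<and>
    set (awalk_verts s (p @ [(x, y)])) = insert y (set (awalk_verts s p))"
proof -
  have e: "awalk x [(x, y)] y"
    using arc_implies_awalk[of "(x, y)"] assms(2) by simp
  have "x \<in> set (awalk_verts s p)"
    using assms(1) by (rule awalkE) (metis last_in_set awalk_verts_non_Nil)
  with set_awalk_verts_append[OF assms(1) e] awalk_appendI[OF assms(1) e]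
  show ?thesis by auto
qed

lemma level_on_awalk:
  assumes "awalk s p u" "x \<in> set (awalk_verts s p)" shows "x = u \<or> h x < h u"
  using assms
proof (induction p arbitrary: u rule: rev_induct)
  case Nil
  then show ?case by (auto simp: awalk_Nil_iff)
next
  case (snoc e p)
  obtain y where e: "e = (y, u)" "(y, u) \<in> parcs G" and p: "awalk s p y"
    using snoc.prems(1) by (cases e) (auto simp: awalk_Cons_iff awalk_Nil_iff)
  show ?case
    using snoc.IH[OF p] snoc.prems(2) set_awalk_verts_snoc[OF p e(2)] level_arc[OF e(2)] e(1)
    by auto
qed

text \<open>The part of dominance that is needed: \<open>merge\<close> returns either the vertex
  itself or the label of its predecessor on this very walk, which lies on the walk by
  induction.\<close>

lemma label_on_awalk:
  assumes L: "labelling h s (parcs G) L" and "awalk s p u"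
  shows "L u \<noteq> 0 \<and> L u - 1 \<in> set (awalk_verts s p)"
  using \<open>awalk s p u\<close>
proof (induction p arbitrary: u rule: rev_induct)
  case Nil
  then show ?case using labelling_source[OF L] by (auto simp: awalk_Nil_iff)
next
  case (snoc e p)
  obtain x where e: "e = (x, u)" "(x, u) \<in> parcs G" and p: "awalk s p x"
    using snoc.prems by (cases e) (auto simp: awalk_Cons_iff awalk_Nil_iff)
  note IH = snoc.IH[OF p]
  have "s \<in> set (awalk_verts s p)" using p by (metis hd_in_awalk_verts(1))
  then have us: "u \<noteq> s" using level_on_awalk[OF p] level_arc[OF e(2)] by force
  have "L x \<in> pred_labels (parcs G) L u"
    using IH e(2) by (auto simp: pred_labels_def)
  moreover have "L u = merge s u (pred_labels (parcs G) L u)"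
    by (rule labelling_merge[OF L us])
  ultimately have "L u = Suc u \<or> L u = L x"
    using merge_cases by metis
  then have "L u \<noteq> 0" "L u - 1 \<in> insert u (set (awalk_verts s p))"
    using IH by auto
  then show ?case using set_awalk_verts_snoc[OF p e(2)] unfolding e(1) by simp
qed

text \<open>The path to the higher end vertex is extended by an arc from a predecessor
  whose label differs from that of the lower one.\<close>

lemma disjoint_awalks:
  assumes L: "labelling h s (parcs G) L" and s: "s \<in> pverts G"
  shows "L u \<noteq> 0 \<Longrightarrow> L v \<noteq> 0 \<Longrightarrow> L u \<noteq> L v \<Longrightarrow>
    \<exists>p q. awalk s p u \<and> awalk s q v \<and> internally_disjoint s p q"
proof (induction "h u + h v" arbitrary: u v rule: less_induct)
  case less
  define D where "D u v \<longleftrightarrow> (\<exists>p q. awalk s p u \<and> awalk s q v \<and> internally_disjoint s p q)" for u v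
  have D_sym: "D u v" if "D v u" for u v
    using that by (auto simp: D_def internally_disjoint_def Int_commute)
  \<comment> \<open>Disjointness is symmetric, so the end vertex that is not the lower one may be
    called \<open>v\<close>; the induction hypothesis then replaces \<open>v\<close> by a
    predecessor and leaves \<open>u\<close> alone.\<close>
  have "D u v" if *: "h u \<le> h v" "L u \<noteq> 0" "L v \<noteq> 0" "L u \<noteq> L v"
    and IH: "\<And>x. h x < h v \<Longrightarrow> L x \<noteq> 0 \<Longrightarrow> L x \<noteq> L u \<Longrightarrow> D u x" for u v
  proof -
    \<comment> \<open>Nothing reachable except \<open>s\<close> itself is as low as
      \<open>s\<close>, so \<open>v = s\<close> would force \<open>u = s\<close>.\<close>
    have "v \<noteq> s"
    proof
      assume "v = s"
      then have "u = s" using labelling_level[OF L, of u] * by auto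
      with \<open>v = s\<close> * show False by simp
    qed
    then have Lv: "L v = merge s v (pred_labels (parcs G) L v)"
      by (rule labelling_merge[OF L])
    \<comment> \<open>Otherwise all reachable predecessors of \<open>v\<close> agree on
      \<open>L u\<close>, which is not \<open>Suc s\<close>, and \<open>v\<close> would inherit
      it.\<close>
    have "\<exists>c\<in>pred_labels (parcs G) L v. c = Suc s \<or> c \<noteq> L u"
    proof (rule ccontr)
      assume none: "\<not> ?thesis"
      have "pred_labels (parcs G) L v \<noteq> {}" using Lv * by (auto simp: merge_def)
      with none have "pred_labels (parcs G) L v = {L u}" "L u \<noteq> Suc s" by auto
      with Lv * show False by (auto simp: merge_def)
    qed
    then obtain x where x: "(x, v) \<in> parcs G" "L x \<noteq> 0" "L x = Suc s \<or> L x \<noteq> L u"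
      by (auto simp: pred_labels_def)
    show "D u v"
    proof (cases "L x = L u")
      case True
      then have "x = s" "u = s" using x labelling_eq_source[OF L] by auto
      then have "awalk s [] u" "awalk s [(s, v)] v" "internally_disjoint s [] [(s, v)]"
        using s x(1) arc_implies_awalk[of "(s, v)"]
        by (auto simp: awalk_Nil_iff internally_disjoint_def)
      then show ?thesis unfolding D_def by blast
    next
      case False
      then obtain p q where pq: "awalk s p u" "awalk s q x" "internally_disjoint s p q"
        using IH[OF level_arc[OF x(1)] x(2)] by (auto simp: D_def)
      \<comment> \<open>All vertices of \<open>p\<close> except its end \<open>u\<close> are lower
        than \<open>u\<close>, hence lower than \<open>v\<close>; so appending the arc to
        \<open>q\<close> keeps the walks disjoint.\<close>
      have "v \<notin> set (awalk_verts s p)"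
        using level_on_awalk[OF pq(1)] * by force
      then have "internally_disjoint s p (q @ [(x, v)])"
        using pq(3) set_awalk_verts_snoc[OF pq(2) x(1)] by (auto simp: internally_disjoint_def)
      then show ?thesis
        using pq(1) set_awalk_verts_snoc[OF pq(2) x(1)] unfolding D_def by blast
    qed
  qed note core = this
  have IH: "D a b" if "h a + h b < h u + h v" "L a \<noteq> 0" "L b \<noteq> 0" "L a \<noteq> L b" for a b
    using less.hyps[OF that] by (simp add: D_def)
  have "D u v"
  proof (cases "h u \<le> h v")
    case True
    show ?thesis by (rule core[OF True less.prems]) (use IH less.prems in force)
  next
    case False
    have "D v u" by (rule core) (use False IH less.prems in force)+
    then show ?thesis by (rule D_sym)
  qed
  then show ?case by (simp add: D_def)
qed

lemma awalk_apath: "awalk s p u \<Longrightarrow> apath s p u"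
proof (induction p arbitrary: u rule: rev_induct)
  case Nil
  then show ?case by (auto simp: awalk_Nil_iff apath_Nil_iff)
next
  case (snoc e p)
  obtain x where e: "e = (x, u)" "(x, u) \<in> parcs G" and p: "awalk s p x"
    using snoc.prems by (cases e) (auto simp: awalk_Cons_iff awalk_Nil_iff)
  have "u \<notin> set (awalk_verts s p)"
    using level_on_awalk[OF p, of u] level_arc[OF e(2)] by auto
  with awalk_verts_append[OF snoc.prems] snoc.IH[OF p] snoc.prems p e show ?case
    by (auto simp: apath_def)
qed

lemma junction_iff_labels:
  assumes L: "labelling h s (parcs G) L" and s: "s \<in> pverts G"
  shows "junction u v s \<longleftrightarrow> L u \<noteq> 0 \<and> L v \<noteq> 0 \<and> L u \<noteq> L v"
proof
  assume "junction u v s"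
  then obtain p q where uv: "u \<noteq> v" and pq: "awalk s p u" "awalk s q v" "internally_disjoint s p q"
    by (auto simp: junction_def apath_def)
  note lab = label_on_awalk[OF L pq(1)] label_on_awalk[OF L pq(2)]
  have "L u \<noteq> L v"
  proof
    assume eq: "L u = L v"
    \<comment> \<open>The vertex named by a common label lies on both walks, so it must be their
      only common vertex.\<close>
    with lab pq(3) have "L u - 1 = s" unfolding internally_disjoint_def by (metis IntI singletonD)
    with lab eq have "L u = Suc s" "L v = Suc s" by auto
    with labelling_eq_source[OF L] uv show False by blast
  qed
  with lab show "L u \<noteq> 0 \<and> L v \<noteq> 0 \<and> L u \<noteq> L v" by blast
next
  assume "L u \<noteq> 0 \<and> L v \<noteq> 0 \<and> L u \<noteq> L v"
  with disjoint_awalks[OF L s] awalk_apath show "junction u v s"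
    unfolding junction_def by blast
qed

end

section \<open>Weakest preconditions for the word RAM\<close>

text \<open>The bound \<open>e\<close> is evaluated anew before every round, so
  \<open>wp_For\<close> asks the invariant to fix its value.\<close>

definition For :: "nat \<Rightarrow> expr \<Rightarrow> prog \<Rightarrow> prog" where
  "For x e P = Seq (Store (Const x) (Const 0))
     (While (Minus e (Cell (Const x))) (Seq P (Store (Const x) (Plus (Cell (Const x)) (Const 1)))))"

text \<open>The absolute difference, used as a test for inequality. One of the truncated differences
  is always 0, so the sum never exceeds the larger operand and cannot overflow.\<close>

definition Dist :: "expr \<Rightarrow> expr \<Rightarrow> expr" where
  "Dist a b = Plus (Minus a b) (Minus b a)"

lemma fits_less: "fits W S inp mem e \<Longrightarrow> val inp mem e < W"
  by (cases e) auto

lemma val_Dist_eq_0 [simp]: "val inp mem (Dist a b) = 0 \<longleftrightarrow> val inp mem a = val inp mem b"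
  by (auto simp: Dist_def)

lemma cost_Dist [simp]: "cost (Dist a b) = 2 * cost a + 2 * cost b + 3"
  by (simp add: Dist_def)

lemma fits_Dist [simp]: "fits W S inp mem (Dist a b) \<longleftrightarrow> fits W S inp mem a \<and> fits W S inp mem b"
  using fits_less[of W S inp mem a] fits_less[of W S inp mem b] by (auto simp: Dist_def)

locale ram =
  fixes W S :: nat and inp :: "nat list"
begin

text \<open>Reading a cell requires its content to be a word. Every run preserves this bound on all
  cells, so the rules for loops carry it along and invariants need not mention it.\<close>

definition bounded :: "memory \<Rightarrow> bool" where
  "bounded mem \<longleftrightarrow> (\<forall>a. mem a < W)"

lemma bounded_less [simp]: "bounded mem \<Longrightarrow> mem a < W"
  by (simp add: bounded_def)

lemma exec_bounded: "exec W S inp P c t c' \<Longrightarrow> bounded (fst c) \<Longrightarrow> bounded (fst c')"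
  by (induction rule: exec.induct) (auto simp: bounded_def dest: fits_less)

text \<open>The postcondition also sees the time, which is accumulated from \<open>t\<close> on, so that the rules for
  loop-free programs are equations.\<close>

definition wp :: "prog \<Rightarrow> memory \<Rightarrow> nat list \<Rightarrow> nat \<Rightarrow> (nat \<Rightarrow> memory \<Rightarrow> nat list \<Rightarrow> bool) \<Rightarrow> bool" where
  "wp P mem out t Q \<longleftrightarrow>
     (\<exists>t' mem' out'. exec W S inp P (mem, out) t' (mem', out') \<and> Q (t + t') mem' out')"

lemma wp_mono:
  "wp P mem out t Q \<Longrightarrow> (\<And>t mem out. Q t mem out \<Longrightarrow> Q' t mem out) \<Longrightarrow> wp P mem out t Q'"
  unfolding wp_def by blast

lemma wp_bounded:
  "wp P mem out t Q \<Longrightarrow> bounded mem \<Longrightarrow> wp P mem out t (\<lambda>t mem out. bounded mem \<and> Q t mem out)"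
  unfolding wp_def using exec_bounded by fastforce

inductive_cases exec_SkipE: "exec W S inp Skip c t c'"
inductive_cases exec_StoreE: "exec W S inp (Store a e) c t c'"
inductive_cases exec_OutputE: "exec W S inp (Output e) c t c'"
inductive_cases exec_SeqE: "exec W S inp (Seq P P') c t c'"
inductive_cases exec_IfE: "exec W S inp (If e P P') c t c'"

lemma exec_Skip_iff: "exec W S inp Skip c t c' \<longleftrightarrow> t = 1 \<and> c' = c"
  by (auto elim: exec_SkipE intro: exec.Skip simp del: One_nat_def)

lemma exec_Store_iff: "exec W S inp (Store a e) (mem, out) t c' \<longleftrightarrow>
    fits W S inp mem a \<and> fits W S inp mem e \<and> val inp mem a < S \<and>
    t = cost a + cost e + 1 \<and> c' = (mem(val inp mem a := val inp mem e), out)"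
  by (auto elim: exec_StoreE intro: exec.Store simp del: One_nat_def add_Suc_right)

lemma exec_Output_iff: "exec W S inp (Output e) (mem, out) t c' \<longleftrightarrow>
    fits W S inp mem e \<and> t = cost e + 1 \<and> c' = (mem, out @ [val inp mem e])"
  by (auto elim: exec_OutputE intro: exec.Output simp del: One_nat_def add_Suc_right)

lemma exec_Seq_iff: "exec W S inp (Seq P P') c t c' \<longleftrightarrow>
    (\<exists>t1 c1 t2. exec W S inp P c t1 c1 \<and> exec W S inp P' c1 t2 c' \<and> t = t1 + t2)"
  by (blast elim: exec_SeqE intro: exec.Seq)

lemma exec_If_iff: "exec W S inp (If e P P') c t c' \<longleftrightarrow> fits W S inp (fst c) e \<and>
    (\<exists>t'. t = cost e + 1 + t' \<and> exec W S inp (if val inp (fst c) e \<noteq> 0 then P else P') c t' c')"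
  by (auto elim!: exec_IfE intro: exec.IfTrue exec.IfFalse simp del: One_nat_def add_Suc_right add_Suc)

lemma wp_Skip [simp]: "wp Skip mem out t Q \<longleftrightarrow> Q (t + 1) mem out"
  by (simp add: wp_def exec_Skip_iff)

lemma wp_Store [simp]: "wp (Store a e) mem out t Q \<longleftrightarrow>
    fits W S inp mem a \<and> fits W S inp mem e \<and> val inp mem a < S \<and>
    Q (t + (cost a + cost e + 1)) (mem(val inp mem a := val inp mem e)) out"
  by (auto simp: wp_def exec_Store_iff)

lemma wp_Output [simp]: "wp (Output e) mem out t Q \<longleftrightarrow>
    fits W S inp mem e \<and> Q (t + (cost e + 1)) mem (out @ [val inp mem e])"
  by (auto simp: wp_def exec_Output_iff)

lemma wp_Seq [simp]: "wp (Seq P P') mem out t Q \<longleftrightarrow> wp P mem out t (\<lambda>t mem out. wp P' mem out t Q)"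
  by (simp add: wp_def exec_Seq_iff) (metis add.assoc)

lemma wp_If [simp]: "wp (If e P P') mem out t Q \<longleftrightarrow> fits W S inp mem e \<and>
    (if val inp mem e \<noteq> 0 then wp P mem out (t + (cost e + 1)) Q else wp P' mem out (t + (cost e + 1)) Q)"
  unfolding wp_def exec_If_iff by (auto simp: add.assoc simp del: One_nat_def)

lemma wp_WhileTrue:
  assumes "fits W S inp mem e" "val inp mem e \<noteq> 0"
    and "wp P mem out (t + (cost e + 1)) (\<lambda>t mem out. wp (While e P) mem out t Q)"
  shows "wp (While e P) mem out t Q"
proof -
  obtain t1 mem1 out1 t2 mem2 out2 where
    "exec W S inp P (mem, out) t1 (mem1, out1)"
    "exec W S inp (While e P) (mem1, out1) t2 (mem2, out2)" "Q (t + (cost e + 1) + t1 + t2) mem2 out2"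
    using assms(3) unfolding wp_def by blast
  moreover from this have "exec W S inp (While e P) (mem, out) (cost e + 1 + t1 + t2) (mem2, out2)"
    using assms by (intro exec.WhileTrue) auto
  ultimately show ?thesis unfolding wp_def by (metis add.assoc)
qed

lemma wp_WhileFalse:
  "fits W S inp mem e \<Longrightarrow> val inp mem e = 0 \<Longrightarrow> Q (t + (cost e + 1)) mem out \<Longrightarrow>
    wp (While e P) mem out t Q"
  unfolding wp_def using exec.WhileFalse[of W S inp "(mem, out)"] by fastforce

text \<open>Termination is obtained from the number \<open>N\<close> of rounds being known in
  advance: \<open>j\<close> counts rounds, and the guard fails exactly at
  \<open>j = N\<close>.\<close>

lemma wp_While:
  assumes "bounded mem" "I 0 t mem out"
    and guard: "\<And>j t mem out. j \<le> N \<Longrightarrow> bounded mem \<Longrightarrow> I j t mem out \<Longrightarrow>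
      fits W S inp mem e \<and> (val inp mem e = 0 \<longleftrightarrow> j = N)"
    and step: "\<And>j t mem out. j < N \<Longrightarrow> bounded mem \<Longrightarrow> I j t mem out \<Longrightarrow>
      wp P mem out (t + (cost e + 1)) (I (Suc j))"
    and post: "\<And>t mem out. bounded mem \<Longrightarrow> I N t mem out \<Longrightarrow> Q (t + (cost e + 1)) mem out"
  shows "wp (While e P) mem out t Q"
proof -
  have "wp (While e P) mem out t Q" if "j \<le> N" "bounded mem" "I j t mem out" for j t mem out
    using that
  proof (induction "N - j" arbitrary: j t mem out)
    case 0
    then show ?case using guard post by (auto intro!: wp_WhileFalse)
  next
    case (Suc d)
    then have j: "j < N" by simp
    show ?case
    proof (rule wp_WhileTrue)
      show "wp P mem out (t + (cost e + 1)) (\<lambda>t mem out. wp (While e P) mem out t Q)"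
        using wp_bounded[OF step[OF j Suc.prems(2,3)] Suc.prems(2)]
      proof (rule wp_mono)
        fix t mem out
        assume "bounded mem \<and> I (Suc j) t mem out"
        then show "wp (While e P) mem out t Q"
          using Suc.hyps(2) j by (intro Suc.hyps(1)[of "Suc j"]) auto
      qed
    qed (use guard[OF Suc.prems] j in auto)
  qed
  then show ?thesis using assms(1,2) by blast
qed

text \<open>The constants: a round costs \<open>K\<close> for the body, \<open>cost e + 4\<close>
  for the guard and 6 for the increment; outside the rounds there are 3 steps of initialisation and
  the final failing guard. The invariant is required after the increment, so it may speak of all
  cells including \<open>x\<close>.\<close>

lemma wp_For:
  assumes "bounded mem" "I 0 (mem(x := 0)) out" "x < S" "x < W" "N < W" "2 \<le> W"
    and bound: "\<And>j mem out. bounded mem \<Longrightarrow> I j mem out \<Longrightarrow>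
      fits W S inp mem e \<and> val inp mem e = N"
    and body: "\<And>j t mem out. j < N \<Longrightarrow> bounded mem \<Longrightarrow> I j mem out \<Longrightarrow> mem x = j \<Longrightarrow>
      wp P mem out t (\<lambda>t' mem' out'. t' \<le> t + K \<and> mem' x = j \<and> I (Suc j) (mem'(x := Suc j)) out')"
    and post: "\<And>t' mem' out'. bounded mem' \<Longrightarrow> t' \<le> t + (N * (K + cost e + 10) + cost e + 7) \<Longrightarrow>
      mem' x = N \<Longrightarrow> I N mem' out' \<Longrightarrow> Q t' mem' out'"
  shows "wp (For x e P) mem out t Q"
proof -
  let ?I = "\<lambda>j t' mem out. I j mem out \<and> mem x = j \<and> t' \<le> t + 3 + j * (K + cost e + 10)"
  have "wp (While (Minus e (Cell (Const x))) (Seq P (Store (Const x) (Plus (Cell (Const x)) (Const 1)))))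
      (mem(x := 0)) out (t + 3) Q"
  proof (rule wp_While[where I = ?I and N = N], goal_cases)
    case (1)
    then show ?case using assms by (auto simp: bounded_def)
  next
    case 2
    then show ?case using assms by simp
  next
    case (3 j t mem out)
    then show ?case using bound[of mem j out] assms(3-6) by auto
  next
    case (4 j t' mem out)
    then show ?case
      apply (simp del: One_nat_def)
      apply (rule wp_mono[OF wp_bounded[OF body[of j mem out]]])
      using assms(3-6) by (auto simp: algebra_simps)
  next
    case (5 t mem out)
    then show ?case by (intro post) auto
  qed
  then show ?thesis using assms(1-6) by (simp add: For_def numeral_3_eq_3)
qed

end

section \<open>The program\<close>

lemma length_flatten [simp]: "length (flatten xs) = 2 * length xs"
  by (induction xs) (auto simp: flatten_def)

lemma flatten_nth:
  "i < length xs \<Longrightarrow> flatten xs ! (2 * i) = fst (xs ! i) \<and> flatten xs ! Suc (2 * i) = snd (xs ! i)"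
proof (induction xs arbitrary: i)
  case (Cons x xs)
  then show ?case by (cases i; cases x) (auto simp: flatten_def)
qed simp

lemma set_flatten: "set (flatten xs) = fst ` set xs \<union> snd ` set xs"
  by (induction xs) (auto simp: flatten_def)

lemma input_nth_arc: "p < 2 * length es \<Longrightarrow> input n es ps ! (3 + p) = flatten es ! p"
  by (simp add: input_def nth_append)

lemma input_nth_pair: "p < 2 * length ps \<Longrightarrow> input n es ps ! (3 + (2 * length es + p)) = flatten ps ! p"
  by (simp add: input_def nth_append)

lemma input_header: "input n es ps ! 0 = n" "input n es ps ! Suc 0 = length es" "input n es ps ! 2 = length ps"
  by (simp_all add: input_def)

lemma length_input: "length (input n es ps) = 3 + 2 * length es + 2 * length ps"
  by (simp add: input_def)

text \<open>Arrays are interleaved, so that addresses do not depend on their common length.\<close>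

definition adr :: "nat \<Rightarrow> nat \<Rightarrow> nat" where
  "adr f p = 10 + f + 7 * p"

lemma adr_eq_iff [simp]: "f < 7 \<Longrightarrow> g < 7 \<Longrightarrow> adr f p = adr g q \<longleftrightarrow> f = g \<and> p = q"
  unfolding adr_def by presburger

lemma adr_neq [simp]: "c < 10 \<Longrightarrow> adr f p \<noteq> c" "c < 10 \<Longrightarrow> c \<noteq> adr f p"
  by (simp_all add: adr_def)

text \<open>Ten scalar cells and seven arrays with indices 0 to \<open>2 * m\<close>, where index
  \<open>2 * m\<close> is the dummy: \<open>10 + 7 * (2 * m + 1) = 17 + 14 * m\<close>.\<close>

lemma adr_less: "f < 7 \<Longrightarrow> p \<le> 2 * m \<Longrightarrow> adr f p < 17 + 14 * m"
  by (simp add: adr_def)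

lemma adr_pos [simp]: "0 < adr f p"
  by (simp add: adr_def)

definition Adr :: "nat \<Rightarrow> expr \<Rightarrow> expr" where
  "Adr f e = Plus (Const (10 + f)) (Times (Const 7) e)"

lemma val_Adr [simp]: "val inp mem (Adr f e) = adr f (val inp mem e)"
  by (simp add: Adr_def adr_def)

lemma cost_Adr [simp]: "cost (Adr f e) = cost e + 4"
  by (simp add: Adr_def)

lemma fits_Adr [simp]: "fits W S inp mem (Adr f e) \<longleftrightarrow> fits W S inp mem e \<and> adr f (val inp mem e) < W"
  by (auto simp: Adr_def adr_def)

abbreviation "Var x \<equiv> Cell (Const x)"
abbreviation "Arr f e \<equiv> Cell (Adr f e)"

definition "Nv = Input (Const 0)"
definition "Mv = Input (Const 1)"
definition "Kv = Input (Const 2)"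
definition "Ends = Plus Mv Mv"
definition "End e = Input (Plus (Const 3) e)"
definition "Tail e = End (Times (Const 2) e)"
definition "Head e = End (Plus (Times (Const 2) e) (Const 1))"
definition "Fst e = Input (Plus (Const 3) (Plus Ends (Times (Const 2) e)))"
definition "Snd e = Input (Plus (Const 3) (Plus Ends (Plus (Times (Const 2) e) (Const 1))))"
definition "TailId e = Arr 0 (Times (Const 2) e)"
definition "HeadId e = Arr 0 (Plus (Times (Const 2) e) (Const 1))"
text \<open>Nested truncated subtraction computes a minimum without branching: the last batch may
  have fewer than \<open>m\<close> pairs.\<close>

definition "Batch = Minus Mv (Minus Mv (Minus Kv (Var 4)))"

lemma cost_exprs [simp]:
  "cost Nv = 2" "cost Mv = 2" "cost Kv = 2" "cost Ends = 5" "cost (End e) = cost e + 3"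
  "cost (Tail e) = cost e + 5" "cost (Head e) = cost e + 7" "cost (Fst e) = cost e + 11"
  "cost (Snd e) = cost e + 13" "cost (TailId e) = cost e + 7" "cost (HeadId e) = cost e + 9"
  "cost Batch = 11"
  by (simp_all add: Nv_def Mv_def Kv_def Ends_def End_def Tail_def Head_def Fst_def Snd_def
      TailId_def HeadId_def Batch_def)

abbreviation same :: "nat set \<Rightarrow> memory \<Rightarrow> memory \<Rightarrow> bool" where
  "same A mem mem' \<equiv> \<forall>a. a \<notin> A \<longrightarrow> mem' a = mem a"

text \<open>
  Cells: \<open>6\<close> and \<open>2\<close> outer and inner loop counters, \<open>3\<close> result of \<open>find_rep\<close>, \<open>4\<close> first pair of the
  current batch, \<open>5\<close> number of arcs sorted so far. Arrays: \<open>0\<close> representatives of the arc ends,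
  \<open>6\<close> heights, \<open>2\<close> sorted arcs, \<open>3\<close> labels, \<open>4\<close> and \<open>5\<close> representatives of the pairs in the batch.
\<close>

definition find_rep :: prog where
  "find_rep = Seq (Store (Const 3) Ends)
     (For 2 Ends (If (Dist (End (Var 2)) (Var 6)) Skip (Store (Const 3) (Var 2))))"

definition arc_reps :: prog where
  "arc_reps = For 6 Nv (Seq find_rep
     (For 2 Ends (If (Dist (End (Var 2)) (Var 6)) Skip (Store (Adr 0 (Var 2)) (Var 3)))))"

text \<open>Since all heights are below \<open>n\<close>, \<open>n\<close> rounds of relaxing all arcs suffice.\<close>

definition levels :: prog where
  "levels = For 6 Nv (For 2 Mv
     (If (Minus (Plus (Cell (Adr 6 (TailId (Var 2)))) (Const 1)) (Cell (Adr 6 (HeadId (Var 2)))))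
       (Store (Adr 6 (HeadId (Var 2))) (Plus (Arr 6 (TailId (Var 2))) (Const 1))) Skip))"

text \<open>A bucket sort without buckets: one scan of the arcs for each possible height costs
  \<open>n * m\<close> altogether, which the time bound can afford.\<close>

definition sort_arcs :: prog where
  "sort_arcs = Seq (Store (Const 5) (Const 0)) (For 6 Nv (For 2 Mv
     (If (Dist (Arr 6 (HeadId (Var 2))) (Var 6)) Skip
       (Seq (Store (Adr 2 (Var 5)) (Var 2)) (Store (Const 5) (Plus (Var 5) (Const 1)))))))"

definition pair_reps :: prog where
  "pair_reps = For 6 Nv (Seq find_rep (For 2 Batch
     (Seq (If (Dist (Fst (Plus (Var 4) (Var 2))) (Var 6)) Skip (Store (Adr 4 (Var 2)) (Var 3)))
          (If (Dist (Snd (Plus (Var 4) (Var 2))) (Var 6)) Skip (Store (Adr 5 (Var 2)) (Var 3))))))"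

definition clear_labels :: prog where
  "clear_labels = For 2 (Plus Ends (Const 1)) (Store (Adr 3 (Var 2)) (Const 0))"

text \<open>\<open>label_step\<close> executed in memory. A fresh label is the head's vertex number
  plus one, not its representative, in agreement with \<open>Suc y\<close>; likewise cell 6 plus one
  is \<open>Suc s\<close>.\<close>

definition set_labels :: prog where
  "set_labels = For 2 Mv
     (If (Arr 3 (TailId (Arr 2 (Var 2))))
       (If (Dist (Arr 3 (TailId (Arr 2 (Var 2)))) (Plus (Var 6) (Const 1)))
         (If (Arr 3 (HeadId (Arr 2 (Var 2))))
           (If (Dist (Arr 3 (HeadId (Arr 2 (Var 2)))) (Arr 3 (TailId (Arr 2 (Var 2)))))
             (Store (Adr 3 (HeadId (Arr 2 (Var 2)))) (Plus (Head (Arr 2 (Var 2))) (Const 1)))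
             Skip)
           (Store (Adr 3 (HeadId (Arr 2 (Var 2)))) (Arr 3 (TailId (Arr 2 (Var 2))))))
         (Store (Adr 3 (HeadId (Arr 2 (Var 2)))) (Plus (Head (Arr 2 (Var 2))) (Const 1))))
       Skip)"

definition test_pairs :: "prog \<Rightarrow> prog" where
  "test_pairs emit = For 2 Batch
     (If (Arr 3 (Arr 4 (Var 2)))
       (If (Arr 3 (Arr 5 (Var 2)))
         (If (Dist (Arr 3 (Arr 4 (Var 2))) (Arr 3 (Arr 5 (Var 2)))) emit Skip) Skip) Skip)"

definition batch_junctions :: "prog \<Rightarrow> prog" where
  "batch_junctions emit = For 6 Nv (Seq find_rep (If (Minus Ends (Var 3))
     (Seq clear_labels (Seq (Store (Adr 3 (Var 3)) (Plus (Var 6) (Const 1)))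
       (Seq set_labels (test_pairs emit)))) Skip))"

definition all_junctions :: "prog \<Rightarrow> prog" where
  "all_junctions emit = Seq arc_reps (Seq levels (Seq sort_arcs (Seq (Store (Const 4) (Const 0))
     (While (Minus Kv (Var 4))
       (Seq pair_reps (Seq (batch_junctions emit) (Store (Const 4) (Plus (Var 4) Mv))))))))"

text \<open>The factor 20 leaves room for every array address and input position;
  \<open>m_pos\<close> makes the batch loop advance, and it lets constant and \<open>n\<close>-sized
  costs be absorbed into \<open>n * m\<close>.\<close>

locale instance_ram = ram W S "input n es ps" for W S n es ps +
  fixes m k :: nat and G
  assumes inst: "is_instance G n es ps"
    and m_def: "m = length es" and k_def: "k = length ps"
    and m_pos: "m \<noteq> 0"
    and W_ge: "20 * (n + m + k + 2) \<le> W" and S_ge: "17 + 14 * m \<le> S"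
begin

abbreviation inp where "inp \<equiv> input n es ps"
definition "E = flatten es"

lemma m_gt: "0 < m" using m_pos by simp

lemma scalar_less [simp]: "c \<le> 16 \<Longrightarrow> c < W" "c < 16 \<Longrightarrow> c < S"
  using W_ge S_ge by simp_all

lemma two_le_W [simp]: "2 \<le> W" using W_ge by simp

lemma size_less [simp]: "n < W" "m < W" "2 * m < W" "Suc (2 * m) < W" "k < W"
  using W_ge by simp_all

definition arr :: "nat \<Rightarrow> nat set" where
  "arr f = adr f ` {..2 * m}"

lemma in_arr [simp]: "f < 7 \<Longrightarrow> g < 7 \<Longrightarrow> adr f p \<in> arr g \<longleftrightarrow> f = g \<and> p \<le> 2 * m" "c < 10 \<Longrightarrow> c \<notin> arr g"
  by (auto simp: arr_def) (simp add: adr_def)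

text \<open>Cell \<open>0\<close> and the cells above the arrays are left to the storing of the answers.\<close>

definition work :: "nat set" where
  "work = {0<..<17 + 14 * m}"

lemma arr_work: "f < 7 \<Longrightarrow> arr f \<subseteq> work"
  using adr_less[of f _ m] by (auto simp: arr_def work_def)

lemma adr_limit [simp]: "f < 7 \<Longrightarrow> p \<le> 2 * m \<Longrightarrow> adr f p < S" "f < 7 \<Longrightarrow> p \<le> 2 * m \<Longrightarrow> adr f p < W"
  using adr_less[of f p m] S_ge W_ge by simp_all

lemma instD: "dag (with_proj G)" "pverts G = {0..<n}" "distinct es" "set es = parcs G"
    "set ps \<subseteq> pverts G \<times> pverts G"
  using inst by (auto simp: is_instance_def)

lemma wf: "wf_digraph (with_proj G)" and fin: "fin_digraph (with_proj G)"
  using instD(1) by (auto simp: dag_def digraph_def fin_digraph_def)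

lemma arc_verts: "x \<in> set es \<Longrightarrow> fst x < n" "x \<in> set es \<Longrightarrow> snd x < n"
  using wf_digraph.wellformed[OF wf, of x] instD by auto

lemma pair_verts: "i < k \<Longrightarrow> fst (ps ! i) < n" "i < k \<Longrightarrow> snd (ps ! i) < n"
  using instD(2) subsetD[OF instD(5) nth_mem[of i ps]] k_def by (auto simp: mem_Times_iff)

lemma length_E [simp]: "length E = 2 * m" by (simp add: E_def m_def)

lemma E_arc: "j < m \<Longrightarrow> E ! (2 * j) = fst (es ! j)" "j < m \<Longrightarrow> E ! Suc (2 * j) = snd (es ! j)"
  using flatten_nth[of j es] by (simp_all add: E_def m_def)

lemma E_less: "p < 2 * m \<Longrightarrow> E ! p < n"
proof -
  assume "p < 2 * m"
  then have "E ! p \<in> set E" by simp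
  then show ?thesis using arc_verts by (auto simp: E_def set_flatten)
qed

lemma val_header [simp]: "val inp mem Nv = n" "val inp mem Mv = m" "val inp mem Kv = k"
    "val inp mem Ends = 2 * m"
  by (simp_all add: Nv_def Mv_def Kv_def Ends_def input_header m_def k_def)

lemma fits_header [simp]: "fits W S inp mem Nv" "fits W S inp mem Mv" "fits W S inp mem Kv"
    "fits W S inp mem Ends"
  using size_less(1,2,3,5) by (simp_all add: Nv_def Mv_def Kv_def Ends_def input_header length_input m_def k_def)

lemma val_End [simp]: "val inp mem e < 2 * m \<Longrightarrow> val inp mem (End e) = E ! val inp mem e"
  by (simp add: End_def input_nth_arc m_def E_def)

lemma fits_End [simp]: "val inp mem e < 2 * m \<Longrightarrow> fits W S inp mem (End e) \<longleftrightarrow> fits W S inp mem e"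
  using E_less[of "val inp mem e"] W_ge
  by (auto simp: End_def input_nth_arc m_def E_def length_input)

lemma double_less [simp]: "j < m \<Longrightarrow> 2 * j < W" "j < m \<Longrightarrow> Suc (2 * j) < W"
  using W_ge by simp_all

lemma val_Tail_Head [simp]:
  "val inp mem e < m \<Longrightarrow> val inp mem (Tail e) = fst (es ! val inp mem e)"
  "val inp mem e < m \<Longrightarrow> val inp mem (Head e) = snd (es ! val inp mem e)"
  by (simp_all add: Tail_def Head_def E_arc)

lemma fits_Tail_Head [simp]:
  "val inp mem e < m \<Longrightarrow> fits W S inp mem (Tail e) \<longleftrightarrow> fits W S inp mem e"
  "val inp mem e < m \<Longrightarrow> fits W S inp mem (Head e) \<longleftrightarrow> fits W S inp mem e"
  by (auto simp: Tail_def Head_def)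

lemma val_Fst_Snd [simp]:
  "val inp mem e < k \<Longrightarrow> val inp mem (Fst e) = fst (ps ! val inp mem e)"
  "val inp mem e < k \<Longrightarrow> val inp mem (Snd e) = snd (ps ! val inp mem e)"
  using input_nth_pair[of "2 * val inp mem e" ps n es] input_nth_pair[of "Suc (2 * val inp mem e)" ps n es]
    flatten_nth[of "val inp mem e" ps]
  by (simp_all add: Fst_def Snd_def k_def m_def)

lemma fits_Fst_Snd [simp]:
  assumes "val inp mem e < k"
  shows "fits W S inp mem (Fst e) \<longleftrightarrow> fits W S inp mem e"
    "fits W S inp mem (Snd e) \<longleftrightarrow> fits W S inp mem e"
  using assms val_Fst_Snd[of mem e] pair_verts[of "val inp mem e"] size_less(1) W_ge
  by (auto simp: Fst_def Snd_def length_input k_def m_def)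

lemma val_Batch [simp]: "val inp mem Batch = min m (k - mem 4)"
  by (auto simp: Batch_def)

lemma fits_Batch [simp]: "bounded mem \<Longrightarrow> fits W S inp mem Batch"
  using size_less by (auto simp: Batch_def intro: le_less_trans[OF diff_le_self])

section \<open>Representatives of vertices\<close>

primrec last_pos :: "nat \<Rightarrow> nat \<Rightarrow> nat" where
  "last_pos v 0 = 2 * m"
| "last_pos v (Suc p) = (if E ! p = v then p else last_pos v p)"

text \<open>The last occurrence, because the scan of \<open>find_rep\<close> overwrites earlier
  hits; the default \<open>2 * m\<close> lies just past the list and serves as the dummy.\<close>

definition "rep v = last_pos v (2 * m)"

lemma last_pos_cases:
  "(\<forall>p<q. E ! p \<noteq> v) \<and> last_pos v q = 2 * m \<or> last_pos v q < q \<and> E ! last_pos v q = v"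
  by (induction q) (auto simp: less_Suc_eq)

lemma rep_in: "v \<in> set E \<Longrightarrow> rep v < 2 * m \<and> E ! rep v = v"
  using last_pos_cases[of "2 * m" v] by (auto simp: rep_def in_set_conv_nth)

lemma rep_notin: "v \<notin> set E \<Longrightarrow> rep v = 2 * m"
  unfolding rep_def by (metis last_pos_cases length_E nth_mem)

lemma rep_le [simp]: "rep v \<le> 2 * m"
  using rep_in[of v] rep_notin[of v] by (cases "v \<in> set E") auto

text \<open>An occurring vertex shares its representative with nobody, not even with an isolated
  vertex. Hence a store at the representative of a head changes the data of that vertex
  only.\<close>

lemma rep_eq_iff: "v \<in> set E \<Longrightarrow> rep v = rep w \<longleftrightarrow> v = w"
  by (metis rep_in rep_notin less_irrefl)

lemma arc_in_E: "j < m \<Longrightarrow> fst (es ! j) \<in> set E" "j < m \<Longrightarrow> snd (es ! j) \<in> set E"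
  using nth_mem[of j es] by (auto simp: E_def set_flatten m_def)

lemma n_pos: "0 < n"
  using arc_verts(1)[of "es ! 0"] m_gt m_def by force

lemma n_le: "n \<le> n * m" and nm_pos: "Suc 0 \<le> n * m" "m \<le> n * m"
  using m_gt n_pos by auto

lemma wp_find_rep:
  assumes "bounded mem"
    and post: "\<And>t' mem'. bounded mem' \<Longrightarrow> t' \<le> t + 100 * m \<Longrightarrow>
      same {2, 3} mem mem' \<Longrightarrow> mem' 3 = rep (mem 6) \<Longrightarrow> Q t' mem' out"
  shows "wp find_rep mem out t Q"
proof -
  let ?I = "\<lambda>j mem' out'. out' = out \<and> same {2, 3} mem mem' \<and>
    mem' 3 = last_pos (mem 6) j"
  have "wp (For 2 Ends (If (Dist (End (Var 2)) (Var 6)) Skip (Store (Const 3) (Var 2))))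
      (mem(3 := 2 * m)) out (t + 7) Q"
  proof (rule wp_For[where I = ?I and N = "2 * m" and K = 22], goal_cases)
    case 1
    then show ?case using assms by (auto simp: bounded_def)
  next
    case (8 j t mem' out')
    then show ?case using bounded_less[OF assms(1), of 6] by auto
  next
    case (9 t' mem' out')
    then show ?case using m_gt by (auto intro!: post simp: rep_def)
  qed auto
  then show ?thesis by (simp add: find_rep_def)
qed

section \<open>Correctness of the phases\<close>

lemma rep_less [simp]: "rep v < W"
  by (rule le_less_trans[OF rep_le]) simp

text \<open>The cost of an outer loop over all vertices in the shape delivered by
  \<open>wp_For\<close>, with \<open>c\<close> the cost of the bound. With at least one arc, both
  \<open>n\<close> and 1 are at most \<open>n * m\<close>.\<close>

lemma time_le:
  assumes "t' \<le> t + (n * (a * m + c + 10) + c + 7)" "a + c + 10 + c + 7 \<le> b"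
  shows "t' \<le> t + b * (n * m)"
proof -
  define N where "N = n * m"
  have "n * (a * m + c + 10) + c + 7 = a * N + (c + 10) * n + (c + 7) * 1"
    by (simp add: N_def algebra_simps)
  also have "\<dots> \<le> a * N + (c + 10) * N + (c + 7) * N"
    unfolding N_def using n_le nm_pos(1) by (intro add_mono mult_le_mono) simp_all
  also have "\<dots> = (a + c + 10 + c + 7) * N" by (simp only: add_mult_distrib add.assoc)
  also have "\<dots> \<le> b * N" using assms(2) by (rule mult_le_mono1)
  finally show ?thesis using assms(1) unfolding N_def by (meson add_left_mono order_trans)
qed

lemma wp_arc_reps:
  assumes bd: "bounded mem"
    and post: "\<And>t' mem'. bounded mem' \<Longrightarrow> t' \<le> t + 300 * (n * m) \<Longrightarrow>
      same ({6, 2, 3} \<union> arr 0) mem mem' \<Longrightarrow> (\<forall>p<2 * m. mem' (adr 0 p) = rep (E ! p)) \<Longrightarrow>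
      Q t' mem' out"
  shows "wp arc_reps mem out t Q"
  unfolding arc_reps_def
proof (rule wp_For[where N = n and K = "200 * m" and
    I = "\<lambda>v mem' out'. out' = out \<and> same ({6, 2, 3} \<union> arr 0) mem mem' \<and>
      (\<forall>p<2 * m. E ! p < v \<longrightarrow> mem' (adr 0 p) = rep (E ! p))"], goal_cases)
  case (8 v t0 mem0 out0)
  note outer = this
  show ?case
  proof (simp only: wp_Seq, rule wp_find_rep, goal_cases)
    case (2 t1 mem1)
    note found = this
    show ?case
    proof (rule wp_For[where N = "2 * m" and K = 27 and
        I = "\<lambda>j mem' out'. out' = out \<and> same ({6, 2, 3} \<union> arr 0) mem mem' \<and> mem' 6 = v \<and>
          mem' 3 = rep v \<and>
          (\<forall>p<2 * m. E ! p < v \<or> E ! p = v \<and> p < j \<longrightarrow> mem' (adr 0 p) = rep (E ! p))"], goal_cases)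
      case (8 j t2 mem2 out2)
      then have "mem2 6 < W" "mem2 3 < W" "adr 0 j < W" "adr 0 j < S" by auto
      with 8 show ?case by (auto simp: less_Suc_eq)
    next
      case (9 t' mem' out')
      then show ?case using found m_gt by (auto simp: less_Suc_eq)
    qed (use found outer in auto)
  qed (use outer in auto)
next
  case (9 t' mem' out')
  have "t' \<le> t + 300 * (n * m)"
    by (rule time_le[OF 9(2)]) simp
  then show ?case using 9 E_less post by auto
qed (use bd in auto)

definition h :: "nat \<Rightarrow> nat" where
  "h = fin_digraph.height (with_proj G)"

lemma acyclic: "\<nexists>p. pre_digraph.cycle (with_proj G) p"
  using instD(1) by (simp add: dag_def)

lemma h_arc: "j < m \<Longrightarrow> h (fst (es ! j)) < h (snd (es ! j))"
  using fin_digraph.height_arc[OF fin acyclic, of "es ! j"] instD(4) nth_mem[of j es]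
  by (simp add: h_def m_def)

lemma h_less: "v < n \<Longrightarrow> h v < n"
  using fin_digraph.height_less[OF fin acyclic, of v] instD(2) by (simp add: h_def)

lemma h_pred:
  assumes "v < n" "h v \<noteq> 0"
  obtains j where "j < m" "snd (es ! j) = v" "h v = Suc (h (fst (es ! j)))"
proof -
  obtain e where "e \<in> set es" "snd e = v" "h v = Suc (h (fst e))"
    using fin_digraph.height_pred[OF fin acyclic, of v] assms instD(2,4) by (auto simp: h_def)
  then show thesis using that by (auto simp: in_set_conv_nth m_def)
qed

lemma set_E_less: "v \<in> set E \<Longrightarrow> v < n"
  using E_less by (auto simp: in_set_conv_nth)

definition reps :: "memory \<Rightarrow> bool" where
  "reps mem \<longleftrightarrow> (\<forall>j<m. mem (adr 0 (2 * j)) = rep (fst (es ! j)) \<and>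
     mem (adr 0 (Suc (2 * j))) = rep (snd (es ! j)))"

lemma repsI: "(\<forall>p<2 * m. mem (adr 0 p) = rep (E ! p)) \<Longrightarrow> reps mem"
  by (simp add: reps_def E_arc)

lemma val_ids [simp]: "reps mem \<Longrightarrow> val inp mem e < m \<Longrightarrow> val inp mem (TailId e) = rep (fst (es ! val inp mem e))"
  "reps mem \<Longrightarrow> val inp mem e < m \<Longrightarrow> val inp mem (HeadId e) = rep (snd (es ! val inp mem e))"
  by (simp_all add: TailId_def HeadId_def reps_def)

lemma fits_ids [simp]: "bounded mem \<Longrightarrow> val inp mem e < m \<Longrightarrow> fits W S inp mem (TailId e) \<longleftrightarrow> fits W S inp mem e"
  "bounded mem \<Longrightarrow> val inp mem e < m \<Longrightarrow> fits W S inp mem (HeadId e) \<longleftrightarrow> fits W S inp mem e"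
  by (auto simp: TailId_def HeadId_def)

lemma reps_same: "reps mem \<Longrightarrow> (\<And>p. p < 2 * m \<Longrightarrow> mem' (adr 0 p) = mem (adr 0 p)) \<Longrightarrow> reps mem'"
  by (simp add: reps_def)

text \<open>Cells start at 0, only grow and never exceed the true height; after \<open>r\<close>
  rounds they are exact up to the cap \<open>r\<close>. Bounding from both sides makes it harmless
  that a round already sees its own updates.\<close>

lemma wp_levels:
  assumes bd: "bounded mem" and reps: "reps mem" and zero: "\<And>p. p \<le> 2 * m \<Longrightarrow> mem (adr 6 p) = 0"
    and post: "\<And>t' mem'. bounded mem' \<Longrightarrow> t' \<le> t + 200 * (n * m) \<Longrightarrow>
      same ({6, 2} \<union> arr 6) mem mem' \<Longrightarrow> (\<forall>v\<in>set E. mem' (adr 6 (rep v)) = h v) \<Longrightarrow>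
      Q t' mem' out"
  shows "wp levels mem out t Q"
  unfolding levels_def
proof (rule wp_For[where N = n and K = "90 * m" and
    I = "\<lambda>r mem' out'. out' = out \<and> same ({6, 2} \<union> arr 6) mem mem' \<and>
      (\<forall>v\<in>set E. min (h v) r \<le> mem' (adr 6 (rep v)) \<and> mem' (adr 6 (rep v)) \<le> h v)"], goal_cases)
  case 2
  then show ?case using zero by auto
next
  case (8 r t0 mem0 out0)
  note outer = this
  show ?case
  proof (rule wp_For[where N = m and K = 66 and
      I = "\<lambda>j mem' out'. out' = out \<and> same ({6, 2} \<union> arr 6) mem mem' \<and> mem' 6 = r \<and>
        (\<forall>v\<in>set E. min (h v) r \<le> mem' (adr 6 (rep v)) \<and> mem' (adr 6 (rep v)) \<le> h v) \<and>
        (\<forall>i<j. min (Suc (h (fst (es ! i)))) (Suc r) \<le> mem' (adr 6 (rep (snd (es ! i)))))"], goal_cases)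
    case (8 j t2 mem2 out2)
    let ?x = "fst (es ! j)" and ?y = "snd (es ! j)"
    let ?a = "mem2 (adr 6 (rep ?x))" and ?b = "mem2 (adr 6 (rep ?y))"
    have xy: "?x \<in> set E" "?y \<in> set E" "h ?x < h ?y"
      using arc_in_E h_arc 8(1) by auto
    have "reps mem2" by (rule reps_same[OF reps]) (use 8 in auto)
    with 8 have val: "val inp mem2 (TailId (Var 2)) = rep ?x" "val inp mem2 (HeadId (Var 2)) = rep ?y"
      "fits W S inp mem2 (TailId (Var 2))" "fits W S inp mem2 (HeadId (Var 2))"
      by auto
    have a: "min (h ?x) r \<le> ?a" "?a \<le> h ?x" using 8 xy by auto
    have a_less: "Suc ?a < W" using a(2) h_less[OF set_E_less[OF xy(1)]] W_ge by simp
    have rep: "rep v = rep ?y \<longleftrightarrow> v = ?y" for v using rep_eq_iff[OF xy(2)] by metis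
    show ?case
    proof (cases "Suc ?a \<le> ?b")
      case True
      then have "min (Suc (h ?x)) (Suc r) \<le> ?b" using a by linarith
      then show ?thesis using val True 8 a_less by (simp add: less_Suc_eq all_conj_distrib)
    next
      case False
      define mem3 where "mem3 = mem2(adr 6 (rep ?y) := Suc ?a)"
      have at: "mem3 (adr 6 (rep v)) = (if v = ?y then Suc ?a else mem2 (adr 6 (rep v)))" for v
        using rep by (simp add: mem3_def)
      have up: "mem2 (adr 6 (rep v)) \<le> mem3 (adr 6 (rep v))" for v
        using False by (cases "v = ?y") (auto simp: at)
      have "min (Suc (h ?x)) (Suc r) \<le> Suc ?a" using a by linarith
      have "min (Suc (h (fst (es ! i)))) (Suc r) \<le> mem3 (adr 6 (rep (snd (es ! i))))"
        if "i < Suc j" for i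
      proof (cases "i = j")
        case True
        then show ?thesis using \<open>min (Suc (h ?x)) (Suc r) \<le> Suc ?a\<close> by (simp add: at)
      next
        case False
        then have "min (Suc (h (fst (es ! i)))) (Suc r) \<le> mem2 (adr 6 (rep (snd (es ! i))))"
          using 8(3) that by auto
        then show ?thesis using up by (rule order_trans)
      qed
      moreover have "\<forall>v\<in>set E. min (h v) r \<le> mem3 (adr 6 (rep v)) \<and> mem3 (adr 6 (rep v)) \<le> h v"
      proof
        fix v assume "v \<in> set E"
        then have "min (h v) r \<le> mem2 (adr 6 (rep v))" "mem2 (adr 6 (rep v)) \<le> h v"
          using 8(3) by auto
        moreover from this(2) have "mem3 (adr 6 (rep v)) \<le> h v"
          using xy(3) a(2) by (simp add: at)
        ultimately show "min (h v) r \<le> mem3 (adr 6 (rep v)) \<and> mem3 (adr 6 (rep v)) \<le> h v"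
          using order_trans[OF _ up] by blast
      qed
      moreover have "same ({6, 2} \<union> arr 6) mem mem3" "mem3 6 = r" "mem3 2 = j"
        using 8 by (auto simp: mem3_def)
      ultimately show ?thesis
        using val False 8(2,3) a_less by (simp flip: mem3_def)
    qed
  next
    case (9 t' mem' out')
    \<comment> \<open>An arc that determines the height of \<open>v\<close> has been relaxed in this
      round, when its tail was already correct up to \<open>r\<close>.\<close>
    have "min (h v) (Suc r) \<le> mem' (adr 6 (rep v))" if v: "v \<in> set E" for v
    proof (cases "h v = 0")
      case False
      then obtain j where "j < m" "snd (es ! j) = v" "h v = Suc (h (fst (es ! j)))"
        using h_pred[OF set_E_less[OF v] False] by blast
      then show ?thesis using 9 by auto
    qed simp
    with 9 show ?case using m_gt by (auto simp: algebra_simps)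
  qed (use outer in auto)
next
  case (9 t' mem' out')
  have "t' \<le> t + 200 * (n * m)"
    by (rule time_le[OF 9(2)]) simp
  moreover have "mem' (adr 6 (rep v)) = h v" if "v \<in> set E" for v
    using 9 that h_less[OF set_E_less[OF that]] by fastforce
  ultimately show ?case using 9 post by auto
qed (use bd in auto)

definition hh :: "nat \<Rightarrow> nat" where
  "hh i = h (snd (es ! i))"

text \<open>The list \<open>ts\<close> exists in the proof only; array 2 holds its entries, which
  are indices of arcs.\<close>

definition arc_order :: "nat set \<Rightarrow> nat list \<Rightarrow> memory \<Rightarrow> bool" where
  "arc_order X ts mem \<longleftrightarrow> distinct ts \<and> set ts = X \<and> sorted (map hh ts) \<and>
     (\<forall>i<length ts. mem (adr 2 i) = ts ! i)"

lemma arc_order_length: "arc_order X ts mem \<Longrightarrow> X \<subseteq> {..<m} \<Longrightarrow> length ts \<le> m"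
  using distinct_card[of ts] card_mono[of "{..<m}" X] by (simp add: arc_order_def)

lemma arc_order_snoc:
  assumes "arc_order X ts mem" "j \<notin> X" "\<And>i. i \<in> X \<Longrightarrow> hh i \<le> hh j"
  shows "arc_order (insert j X) (ts @ [j]) (mem(adr 2 (length ts) := j))"
  using assms by (auto simp: arc_order_def sorted_append nth_append less_Suc_eq)

lemma arc_order_cong:
  "arc_order X ts mem \<Longrightarrow> X = Y \<Longrightarrow> (\<And>i. i < length ts \<Longrightarrow> mem' (adr 2 i) = mem (adr 2 i)) \<Longrightarrow> arc_order Y ts mem'"
  by (simp add: arc_order_def)

lemma wp_sort_arcs:
  assumes bd: "bounded mem" and reps: "reps mem" and lev: "\<forall>v\<in>set E. mem (adr 6 (rep v)) = h v"
    and post: "\<And>t' mem' ts. bounded mem' \<Longrightarrow> t' \<le> t + 200 * (n * m) \<Longrightarrow>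
      same ({6, 2, 5} \<union> arr 2) mem mem' \<Longrightarrow> arc_order {..<m} ts mem' \<Longrightarrow> Q t' mem' out"
  shows "wp sort_arcs mem out t Q"
proof -
  have "wp (For 6 Nv (For 2 Mv (If (Dist (Arr 6 (HeadId (Var 2))) (Var 6)) Skip
       (Seq (Store (Adr 2 (Var 5)) (Var 2)) (Store (Const 5) (Plus (Var 5) (Const 1)))))))
    (mem(5 := 0)) out (t + 3) Q"
  proof (rule wp_For[where N = n and K = "90 * m" and
      I = "\<lambda>r mem' out'. out' = out \<and> same ({6, 2, 5} \<union> arr 2) mem mem' \<and>
        (\<exists>ts. arc_order {i. i < m \<and> hh i < r} ts mem' \<and> mem' 5 = length ts)"], goal_cases)
    case 1
    then show ?case using bd by (auto simp: bounded_def)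
  next
    case 2
    then show ?case by (auto simp: arc_order_def)
  next
    case (8 r t0 mem0 out0)
    note outer = this
    show ?case
    proof (rule wp_For[where N = m and K = 60 and
        I = "\<lambda>j mem' out'. out' = out \<and> same ({6, 2, 5} \<union> arr 2) mem mem' \<and> mem' 6 = r \<and>
          (\<exists>ts. arc_order {i. i < m \<and> (hh i < r \<or> hh i = r \<and> i < j)} ts mem' \<and> mem' 5 = length ts)"],
        goal_cases)
      case 2
      obtain ts where "arc_order {i. i < m \<and> hh i < r} ts mem0" "mem0 5 = length ts"
        using outer by blast
      then have "arc_order {i. i < m \<and> (hh i < r \<or> hh i = r \<and> i < 0)} ts (mem0(2 := 0)) \<and>
          (mem0(2 := 0)) 5 = length ts"
        by (auto elim: arc_order_cong)
      then show ?case using outer by auto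
    next
      case (8 j t2 mem2 out2)
      let ?X = "\<lambda>j. {i. i < m \<and> (hh i < r \<or> hh i = r \<and> i < j)}"
      obtain ts where ts: "arc_order (?X j) ts mem2" "mem2 5 = length ts"
        using 8 by blast
      have reps2: "reps mem2" by (rule reps_same[OF reps]) (use 8 in auto)
      have lev2: "mem2 (adr 6 (rep (snd (es ! j)))) = hh j"
        using 8 lev arc_in_E by (auto simp: hh_def)
      have st: "out2 = out" "same ({6, 2, 5} \<union> arr 2) mem mem2" "mem2 6 = r"
        using 8(3) by auto
      have less: "j < W" "hh j < W" "r < W"
        using bounded_less[OF 8(2), of 2] bounded_less[OF 8(2), of "adr 6 (rep (snd (es ! j)))"]
          bounded_less[OF 8(2), of 6] 8(4) lev2 st(3) by simp_all
      show ?case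
      proof (cases "hh j = r")
        case False
        then have X: "?X j = ?X (Suc j)" by (auto simp: less_Suc_eq)
        have "arc_order (?X (Suc j)) ts (mem2(2 := Suc j))"
          by (rule arc_order_cong[OF ts(1) X]) simp
        then have "\<exists>ts. arc_order (?X (Suc j)) ts (mem2(2 := Suc j)) \<and> mem2 5 = length ts"
          using ts(2) by blast
        then show ?thesis using 8(1,2,4) st reps2 lev2 False less by simp
      next
        case True
        have X: "?X (Suc j) = insert j (?X j)" using 8(1) True by (auto simp: less_Suc_eq)
        have snoc: "arc_order (?X (Suc j)) (ts @ [j]) (mem2(adr 2 (length ts) := j))"
          unfolding X by (rule arc_order_snoc[OF ts(1)]) (use True in auto)
        have "?X (Suc j) \<subseteq> {..<m}" by auto
        \<comment> \<open>Strictness comes from the list after appending \<open>j\<close>, which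
          still consists of distinct indices below \<open>m\<close>.\<close>
        then have len: "length ts < m" using arc_order_length[OF snoc] by simp
        have "arc_order (?X (Suc j)) (ts @ [j])
            (mem2(adr 2 (length ts) := j, 5 := Suc (length ts), 2 := Suc j))"
          by (rule arc_order_cong[OF snoc]) auto
        then have "\<exists>ts'. arc_order (?X (Suc j)) ts'
            (mem2(adr 2 (length ts) := j, 5 := Suc (length ts), 2 := Suc j)) \<and> Suc (length ts) = length ts'"
          by (intro exI[of _ "ts @ [j]"]) simp
        moreover have "Suc (length ts) < W" using len W_ge by simp
        ultimately show ?thesis using 8(1,2,4) st reps2 lev2 True ts(2) len less by simp
      qed
    next
      case (9 t' mem' out')
      have "{i. i < m \<and> (hh i < r \<or> hh i = r \<and> i < m)} = {i. i < m \<and> hh i < Suc r}"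
        by auto
      with 9(4) obtain ts where "arc_order {i. i < m \<and> hh i < Suc r} ts mem'" "mem' 5 = length ts"
        by auto
      then have "arc_order {i. i < m \<and> hh i < Suc r} ts (mem'(6 := Suc r)) \<and>
          (mem'(6 := Suc r)) 5 = length ts"
        by (auto elim: arc_order_cong)
      moreover have "t' \<le> t0 + 90 * m" using 9(2) m_gt by simp
      ultimately show ?case using 9 by auto
    qed (use outer in auto)
  next
    case (9 t' mem' out')
    have "t' \<le> (t + 3) + 190 * (n * m)"
      by (rule time_le[OF 9(2)]) simp
    then have "t' \<le> t + 200 * (n * m)" using nm_pos(1) by linarith
    moreover have "{i. i < m \<and> hh i < n} = {..<m}"
      using h_less set_E_less arc_in_E by (auto simp: hh_def)
    ultimately show ?case using 9 by (auto intro: post)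
  qed auto
  then show ?thesis by (simp add: sort_arcs_def numeral_3_eq_3)
qed

definition pairs_at :: "nat \<Rightarrow> memory \<Rightarrow> bool" where
  "pairs_at b mem \<longleftrightarrow> (\<forall>i<min m (k - b). mem (adr 4 i) = rep (fst (ps ! (b + i))) \<and>
     mem (adr 5 i) = rep (snd (ps ! (b + i))))"

lemma wp_pair_reps:
  assumes bd: "bounded mem" and b: "mem 4 = b"
    and post: "\<And>t' mem'. bounded mem' \<Longrightarrow> t' \<le> t + 400 * (n * m) \<Longrightarrow>
      same ({6, 2, 3} \<union> arr 4 \<union> arr 5) mem mem' \<Longrightarrow> pairs_at b mem' \<Longrightarrow> Q t' mem' out"
  shows "wp pair_reps mem out t Q"
  unfolding pair_reps_def
proof (rule wp_For[where N = n and K = "300 * m" and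
    I = "\<lambda>v mem' out'. out' = out \<and> same ({6, 2, 3} \<union> arr 4 \<union> arr 5) mem mem' \<and>
      (\<forall>i<min m (k - b). (fst (ps ! (b + i)) < v \<longrightarrow> mem' (adr 4 i) = rep (fst (ps ! (b + i)))) \<and>
        (snd (ps ! (b + i)) < v \<longrightarrow> mem' (adr 5 i) = rep (snd (ps ! (b + i)))))"], goal_cases)
  case (8 v t0 mem0 out0)
  note outer = this
  have b0: "mem0 4 = b" using 8 b by simp
  show ?case
  proof (simp only: wp_Seq, rule wp_find_rep, goal_cases)
    case (2 t1 mem1)
    note found = this
    have b1: "mem1 4 = b" using found b0 by simp
    show ?case
    proof (rule wp_For[where N = "min m (k - b)" and K = 110 and
        I = "\<lambda>j mem' out'. out' = out \<and> same ({6, 2, 3} \<union> arr 4 \<union> arr 5) mem mem' \<and> mem' 6 = v \<and>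
          mem' 3 = rep v \<and> mem' 4 = b \<and>
          (\<forall>i<min m (k - b). (fst (ps ! (b + i)) < v \<or> fst (ps ! (b + i)) = v \<and> i < j \<longrightarrow>
              mem' (adr 4 i) = rep (fst (ps ! (b + i)))) \<and>
            (snd (ps ! (b + i)) < v \<or> snd (ps ! (b + i)) = v \<and> i < j \<longrightarrow>
              mem' (adr 5 i) = rep (snd (ps ! (b + i)))))"], goal_cases)
      case 2
      then show ?case using found outer b1 by auto
    next
      case (8 j t2 mem2 out2)
      then have st: "mem2 6 = v" "mem2 3 = rep v" "mem2 4 = b" "mem2 2 = j" "out2 = out" by auto
      have j: "j < m" "b + j < k" using 8(1) by auto
      have less: "v < W" "b < W" "j < W" "b + j < W"
        using bounded_less[OF 8(2), of 6] bounded_less[OF 8(2), of 4] bounded_less[OF 8(2), of 2]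
          st size_less(5) j by linarith+
      let ?u = "\<lambda>i. fst (ps ! (b + i))" and ?w = "\<lambda>i. snd (ps ! (b + i))"
      \<comment> \<open>Stated for an arbitrary memory with the right entries, so that one argument
        covers all four outcomes of the two tests.\<close>
      have inv: "\<forall>i<min m (k - b).
          (?u i < v \<or> ?u i = v \<and> i < Suc j \<longrightarrow> mem3 (adr 4 i) = rep (?u i)) \<and>
          (?w i < v \<or> ?w i = v \<and> i < Suc j \<longrightarrow> mem3 (adr 5 i) = rep (?w i))"
        if mem3: "\<And>i. mem3 (adr 4 i) = (if i = j \<and> ?u j = v then rep v else mem2 (adr 4 i))"
          "\<And>i. mem3 (adr 5 i) = (if i = j \<and> ?w j = v then rep v else mem2 (adr 5 i))" for mem3
      proof -
        have u: "mem3 (adr 4 i) = rep (?u i)"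
          if i: "i < min m (k - b)" "?u i < v \<or> ?u i = v \<and> i < Suc j" for i
        proof (cases "i = j \<and> ?u j = v")
          case False
          then have "?u i < v \<or> ?u i = v \<and> i < j" using i(2) by (auto simp: less_Suc_eq)
          then have "mem2 (adr 4 i) = rep (?u i)" using 8(3) i(1) by blast
          then show ?thesis using False by (simp add: mem3(1))
        qed (simp add: mem3(1))
        have w: "mem3 (adr 5 i) = rep (?w i)"
          if i: "i < min m (k - b)" "?w i < v \<or> ?w i = v \<and> i < Suc j" for i
        proof (cases "i = j \<and> ?w j = v")
          case False
          then have "?w i < v \<or> ?w i = v \<and> i < j" using i(2) by (auto simp: less_Suc_eq)
          then have "mem2 (adr 5 i) = rep (?w i)" using 8(3) i(1) by blast
          then show ?thesis using False by (simp add: mem3(2))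
        qed (simp add: mem3(2))
        show ?thesis by (intro allI impI conjI) (rule u w; assumption)+
      qed
      have same: "same ({6, 2, 3} \<union> arr 4 \<union> arr 5) mem mem2" using 8(3) by simp
      note facts = 8(2) st less j same
      show ?case
      proof (cases "?u j = v"; cases "?w j = v")
        assume uw: "?u j = v" "?w j = v"
        have "\<forall>i<min m (k - b).
            (?u i < v \<or> ?u i = v \<and> i < Suc j \<longrightarrow> (mem2(adr 4 j := rep v, adr 5 j := rep v, 2 := Suc j)) (adr 4 i) = rep (?u i)) \<and>
            (?w i < v \<or> ?w i = v \<and> i < Suc j \<longrightarrow> (mem2(adr 4 j := rep v, adr 5 j := rep v, 2 := Suc j)) (adr 5 i) = rep (?w i))"
          by (rule inv) (use uw in auto)
        then show ?thesis using facts uw pair_verts[OF j(2)] by simp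
      next
        assume uw: "?u j = v" "?w j \<noteq> v"
        have "\<forall>i<min m (k - b).
            (?u i < v \<or> ?u i = v \<and> i < Suc j \<longrightarrow> (mem2(adr 4 j := rep v, 2 := Suc j)) (adr 4 i) = rep (?u i)) \<and>
            (?w i < v \<or> ?w i = v \<and> i < Suc j \<longrightarrow> (mem2(adr 4 j := rep v, 2 := Suc j)) (adr 5 i) = rep (?w i))"
          by (rule inv) (use uw in auto)
        then show ?thesis using facts uw pair_verts[OF j(2)] by simp
      next
        assume uw: "?u j \<noteq> v" "?w j = v"
        have "\<forall>i<min m (k - b).
            (?u i < v \<or> ?u i = v \<and> i < Suc j \<longrightarrow> (mem2(adr 5 j := rep v, 2 := Suc j)) (adr 4 i) = rep (?u i)) \<and>
            (?w i < v \<or> ?w i = v \<and> i < Suc j \<longrightarrow> (mem2(adr 5 j := rep v, 2 := Suc j)) (adr 5 i) = rep (?w i))"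
          by (rule inv) (use uw in auto)
        then show ?thesis using facts uw pair_verts[OF j(2)] by simp
      next
        assume uw: "?u j \<noteq> v" "?w j \<noteq> v"
        have "\<forall>i<min m (k - b).
            (?u i < v \<or> ?u i = v \<and> i < Suc j \<longrightarrow> (mem2(2 := Suc j)) (adr 4 i) = rep (?u i)) \<and>
            (?w i < v \<or> ?w i = v \<and> i < Suc j \<longrightarrow> (mem2(2 := Suc j)) (adr 5 i) = rep (?w i))"
          by (rule inv) (use uw in auto)
        then show ?thesis using facts uw pair_verts[OF j(2)] by simp
      qed
    next
      case (9 t' mem' out')
      have "min m (k - b) * 131 \<le> m * 131" by simp
      then have "t' \<le> t0 + 300 * m" using 9(2) found(2) m_gt by simp
      then show ?case using 9(3,4) by (simp add: less_Suc_eq)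
    next
      case 5
      show ?case using size_less(2) by (simp add: min_less_iff_disj)
    qed (use found outer in auto)
  qed (use outer in auto)
next
  case (9 t' mem' out')
  have "t' \<le> t + 400 * (n * m)"
    by (rule time_le[OF 9(2)]) simp
  moreover have "pairs_at b mem'"
    using 9(4) pair_verts by (simp add: pairs_at_def less_diff_conv add.commute)
  ultimately show ?case using 9 post by blast
qed (use bd in auto)

lemma wp_clear_labels:
  assumes bd: "bounded mem"
    and post: "\<And>t' mem'. bounded mem' \<Longrightarrow> t' \<le> t + 100 * m \<Longrightarrow>
      same ({2} \<union> arr 3) mem mem' \<Longrightarrow> (\<forall>p\<le>2 * m. mem' (adr 3 p) = 0) \<Longrightarrow> Q t' mem' out"
  shows "wp clear_labels mem out t Q"
  unfolding clear_labels_def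
\<comment> \<open>One round more than there are positions: the dummy's label must be cleared
  too.\<close>
proof (rule wp_For[where N = "2 * m + 1" and K = 8 and
    I = "\<lambda>j mem' out'. out' = out \<and> same ({2} \<union> arr 3) mem mem' \<and> (\<forall>p<j. mem' (adr 3 p) = 0)"],
    goal_cases)
  case (8 j t0 mem0 out0)
  have "j < W" using bounded_less[OF 8(2), of 2] 8(4) by simp
  with 8 show ?case by (auto simp: less_Suc_eq)
next
  case (9 t' mem' out')
  then show ?case using m_gt by (auto intro!: post)
qed (use bd in auto)

lemma fst_less_snd: "(a, b) \<in> set es \<Longrightarrow> h a < h b"
  using h_arc unfolding in_set_conv_nth m_def by force

text \<open>The invariant reads the labelling off memory through representatives, as a function on
  all vertices. Isolated vertices share the dummy cell, which stays 0 since it is never the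
  representative of a head.\<close>

lemma wp_set_labels:
  assumes bd: "bounded mem" and reps: "reps mem" and ord: "arc_order {..<m} ts mem"
    and s: "mem 6 = s" and s_less: "s < n"
    and init: "\<And>v. mem (adr 3 (rep v)) = (if v = s then Suc s else 0)"
    and post: "\<And>t' mem' L. bounded mem' \<Longrightarrow> t' \<le> t + 250 * m \<Longrightarrow>
      same ({2} \<union> arr 3) mem mem' \<Longrightarrow> labelling h s (set es) L \<Longrightarrow> (\<forall>v. mem' (adr 3 (rep v)) = L v) \<Longrightarrow>
      Q t' mem' out"
  shows "wp set_labels mem out t Q"
  unfolding set_labels_def
proof (rule wp_For[where N = m and K = 220 and
    I = "\<lambda>j mem' out'. out' = out \<and> same ({2} \<union> arr 3) mem mem' \<and>
      labelling h s (set (map ((!) es) (take j ts))) (\<lambda>v. mem' (adr 3 (rep v)))"], goal_cases)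
  case 2
  have "(\<lambda>v. (mem(2 := 0)) (adr 3 (rep v))) = (\<lambda>_. 0)(s := Suc s)" by (auto simp: init)
  then show ?case using labelling_init by simp
next
  case (8 j t0 mem0 out0)
  have len: "length ts = m" and set_ts: "set ts = {..<m}"
    using ord distinct_card[of ts] by (simp_all add: arc_order_def)
  define i where "i = ts ! j"
  have i: "i < m" using 8(1) len set_ts nth_mem[of j ts] by (simp add: i_def)
  let ?x = "fst (es ! i)" and ?y = "snd (es ! i)"
  let ?L = "\<lambda>mem v. mem (adr 3 (rep v))"
  have xy: "?x \<in> set E" "?y \<in> set E" "h ?x < h ?y" using arc_in_E h_arc i by auto
  have st: "out0 = out" "same ({2} \<union> arr 3) mem mem0" "mem0 2 = j"
    and lab: "labelling h s (set (map ((!) es) (take j ts))) (?L mem0)"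
    using 8 by auto
  have reps0: "reps mem0" by (rule reps_same[OF reps]) (use st in auto)
  have cells: "mem0 6 = s" "mem0 (adr 2 j) = i"
    using st s ord 8(1) len by (auto simp: arc_order_def i_def)
  have less: "s < W" "i < W" "j < W"
    using bounded_less[OF 8(2), of 6] bounded_less[OF 8(2), of "adr 2 j"] bounded_less[OF 8(2), of 2]
      cells st by auto
  have limits: "Suc s < W" "Suc ?y < W"
    using s_less set_E_less[OF xy(2)] W_ge by simp_all
  have rep: "rep v = rep ?y \<longleftrightarrow> v = ?y" for v using rep_eq_iff[OF xy(2)] by metis
  have step: "labelling h s (set (map ((!) es) (take (Suc j) ts))) (?L mem')"
    if "?L mem' = label_step s ?x ?y (?L mem0)" for mem'
  proof -
    have "set (map ((!) es) (take (Suc j) ts)) = insert (?x, ?y) (set (map ((!) es) (take j ts)))"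
      using 8(1) len by (simp add: take_Suc_conv_app_nth i_def)
    moreover have "h b \<le> h ?y" if ab: "(a, b) \<in> set (map ((!) es) (take j ts))" for a b
    proof -
      obtain q where q: "q < j" "(a, b) = es ! (ts ! q)"
        using ab 8(1) len by (auto simp: in_set_conv_nth)
      then have "hh (ts ! q) \<le> hh (ts ! j)"
        using ord 8(1) len sorted_nth_mono[of "map hh ts" q j] by (simp add: arc_order_def)
      then show ?thesis using q(2)[symmetric] by (simp add: hh_def i_def)
    qed
    moreover have "h a < h b" if "(a, b) \<in> set (map ((!) es) (take j ts))" for a b
    proof (rule fst_less_snd)
      have "set (take j ts) \<subseteq> {..<m}" using set_take_subset[of j ts] set_ts by simp
      then have "es ! p \<in> set es" if "p \<in> set (take j ts)" for p
        using that m_def by (intro nth_mem) auto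
      then show "(a, b) \<in> set es" using that by force
    qed
    ultimately show ?thesis
      unfolding that using labelling_step[OF lab xy(3)] by simp
  qed
  \<comment> \<open>Since the head occurs in an arc, one store corresponds to one function update on
    vertices.\<close>
  have upd: "?L (mem0(adr 3 (rep ?y) := c, 2 := Suc j)) = (?L mem0)(?y := c)" for c
    using rep by (auto simp: fun_eq_iff)
  have upd_Skip: "?L (mem0(2 := Suc j)) = ?L mem0" by auto
  have fr: "same ({2} \<union> arr 3) mem (mem0(adr 3 (rep ?y) := c, 2 := Suc j))"
      "same ({2} \<union> arr 3) mem (mem0(2 := Suc j))" for c
    using st(2) by auto
  note facts = 8(1,2) st cells less limits reps0 i
  show ?case
  proof (cases "?L mem0 ?x = 0")
    case True
    then have "?L (mem0(2 := Suc j)) = label_step s ?x ?y (?L mem0)"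
      unfolding upd_Skip by (simp add: label_step_def)
    from step[OF this] show ?thesis using facts fr(2) True by simp
  next
    case nz: False
    show ?thesis
    proof (cases "?L mem0 ?x = Suc s")
      case True
      then have "?L (mem0(adr 3 (rep ?y) := Suc ?y, 2 := Suc j)) = label_step s ?x ?y (?L mem0)"
        unfolding upd by (simp add: label_step_def)
      from step[OF this] show ?thesis using facts fr(1)[of "Suc ?y"] True by simp
    next
      case ns: False
      show ?thesis
      proof (cases "?L mem0 ?y = 0")
        case True
        then have "?L (mem0(adr 3 (rep ?y) := ?L mem0 ?x, 2 := Suc j)) = label_step s ?x ?y (?L mem0)"
          unfolding upd using nz ns by (simp add: label_step_def)
        from step[OF this] show ?thesis
          using facts fr(1)[of "?L mem0 ?x"] nz ns True by simp
      next
        case nz': False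
        show ?thesis
        proof (cases "?L mem0 ?y = ?L mem0 ?x")
          case True
          then have "?L (mem0(2 := Suc j)) = label_step s ?x ?y (?L mem0)"
            unfolding upd_Skip using nz ns by (auto simp: label_step_def)
          from step[OF this] show ?thesis using facts fr(2) nz ns nz' True by simp
        next
          case False
          then have "?L (mem0(adr 3 (rep ?y) := Suc ?y, 2 := Suc j)) = label_step s ?x ?y (?L mem0)"
            unfolding upd using nz ns nz' by (simp add: label_step_def)
          from step[OF this] show ?thesis
            using facts fr(1)[of "Suc ?y"] nz ns nz' False by simp
        qed
      qed
    qed
  qed
next
  case (9 t' mem' out')
  have len: "length ts = m" and set_ts: "set ts = {..<m}"
    using ord distinct_card[of ts] by (simp_all add: arc_order_def)
  have "set (map ((!) es) (take m ts)) = (!) es ` {..<m}"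
    using len set_ts by simp
  also have "\<dots> = set es" by (auto simp: m_def set_conv_nth)
  finally show ?case using 9 m_gt by (auto intro!: post)
qed (use bd in auto)

section \<open>Book-keeping of the answers delivered so far\<close>

definition answers :: "(nat \<times> nat) set" where
  "answers = {(i, s). i < k \<and> s \<in> junctions_of G (ps ! i)}"

lemma levelled: "levelled_digraph G h"
  using wf fst_less_snd instD(4)
  by (auto simp: levelled_digraph_def levelled_digraph_axioms_def)

lemma answers_iff_labels:
  assumes "labelling h s (set es) L" "s < n" "i < k"
  shows "(i, s) \<in> answers \<longleftrightarrow>
    L (fst (ps ! i)) \<noteq> 0 \<and> L (snd (ps ! i)) \<noteq> 0 \<and> L (fst (ps ! i)) \<noteq> L (snd (ps ! i))"
  using levelled_digraph.junction_iff_labels[OF levelled, of s L] assms instD(2,4)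
  by (auto simp: answers_def junctions_of_def split: prod.split)

lemma answers_less: "(i, s) \<in> answers \<Longrightarrow> i < k \<and> s < n"
  using wf_digraph.awalk_hd_in_verts[OF wf] instD(2)
  by (auto simp: answers_def junctions_of_def pre_digraph.junction_def pre_digraph.apath_def split: prod.splits)

text \<open>For an isolated source the labelling marks the source alone, whereas a junction needs
  two different nonzero labels. This justifies skipping such sources.\<close>

lemma answers_in_E:
  assumes "(i, s) \<in> answers" shows "s \<in> set E"
proof (rule ccontr)
  assume "s \<notin> set E"
  then have s: "(s, y) \<notin> set es" "(x, s) \<notin> set es" for x y
    by (force simp: E_def set_flatten)+
  have "labelling h s (set es) ((\<lambda>_. 0)(s := Suc s))"
    using s by (auto simp: labelling_def merge_def pred_labels_def)
  from answers_iff_labels[OF this] assms answers_less[OF assms] show False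
    by (auto split: if_splits)
qed

text \<open>The answers delivered when \<open>b\<close> pairs are done for all sources, and the current batch is done for
  the sources below \<open>s\<close>, as are its first \<open>j\<close> pairs for \<open>s\<close>.\<close>

definition found :: "nat \<Rightarrow> nat \<Rightarrow> nat \<Rightarrow> (nat \<times> nat) set" where
  "found b s j = {(i, s') \<in> answers. i < b \<or> i < b + m \<and> (s' < s \<or> s' = s \<and> i < b + j)}"

lemma found_Suc:
  assumes "b + j < k" "j < m"
  shows "found b s (Suc j) = (if (b + j, s) \<in> answers then insert (b + j, s) (found b s j) else found b s j)"
  using assms by (auto simp: found_def less_Suc_eq)

text \<open>Provides the freshness demanded by \<open>emit\<close>, hence the absence of repetitions
  in the result.\<close>

lemma found_fresh: "(b + j, s) \<notin> found b s j"
  by (simp add: found_def)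

text \<open>A short last batch does no harm: answers have pair indices below \<open>k\<close>, so
  nothing lies between the end of the batch and \<open>b + m\<close>.\<close>

lemma found_next_source: "found b s (min m (k - b)) = found b (Suc s) 0"
  using answers_less by (auto simp: found_def less_Suc_eq) (metis add_less_cancel_left add_diff_inverse_nat less_diff_conv2 not_less not_less_iff_gr_or_eq min_def add.commute less_diff_conv)

lemma found_isolated: "s \<notin> set E \<Longrightarrow> found b s 0 = found b (Suc s) 0"
  using answers_in_E by (auto simp: found_def less_Suc_eq)

lemma found_next_batch: "found b n 0 = found (b + m) 0 0"
  using answers_less by (auto simp: found_def)

lemma found_start: "found 0 0 0 = {}"
  by (simp add: found_def)

lemma found_all: "k \<le> b \<Longrightarrow> found b 0 0 = answers"
  using answers_less by (fastforce simp: found_def)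

end

section \<open>The algorithm with an abstract delivery of answers\<close>

text \<open>\<open>sink X\<close> says that exactly the answers in \<open>X\<close> have been delivered so far.\<close>

locale junction_ram = instance_ram +
  fixes emit :: prog and emit_time :: nat and sink :: "(nat \<times> nat) set \<Rightarrow> memory \<Rightarrow> nat list \<Rightarrow> bool"
  assumes sink_same: "sink X mem out \<Longrightarrow> same work mem mem' \<Longrightarrow> sink X mem' out"
    and emit: "bounded mem \<Longrightarrow> sink X mem out \<Longrightarrow> mem 4 + mem 2 = i \<Longrightarrow> mem 6 = s \<Longrightarrow>
      i < k \<Longrightarrow> s < n \<Longrightarrow> (i, s) \<notin> X \<Longrightarrow>
      wp emit mem out t (\<lambda>t' mem' out'. t' \<le> t + emit_time \<and> same (- work) mem mem' \<and>
        sink (insert (i, s) X) mem' out')"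
begin

lemma scalar_work [simp]: "0 < c \<Longrightarrow> c < 10 \<Longrightarrow> c \<in> work"
  by (simp add: work_def)

lemma adr_work [simp]: "f < 7 \<Longrightarrow> p \<le> 2 * m \<Longrightarrow> adr f p \<in> work"
  using adr_less[of f p m] by (simp add: work_def)

lemma sink_same_subset: "sink X mem out \<Longrightarrow> same A mem mem' \<Longrightarrow> A \<subseteq> work \<Longrightarrow> sink X mem' out"
  by (rule sink_same) (blast+)

lemma wp_test_pairs:
  assumes bd: "bounded mem" and b: "mem 4 = b" and s: "mem 6 = s" "s < n"
    and pairs: "pairs_at b mem"
    and lab: "labelling h s (set es) L" "\<forall>v. mem (adr 3 (rep v)) = L v"
    and sink: "sink (found b s 0) mem out"
    and post: "\<And>t' mem' out'. bounded mem' \<Longrightarrow> t' \<le> t + (120 + emit_time) * m \<Longrightarrow>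
      same ({2} \<union> - work) mem mem' \<Longrightarrow> sink (found b (Suc s) 0) mem' out' \<Longrightarrow> Q t' mem' out'"
  shows "wp (test_pairs emit) mem out t Q"
  unfolding test_pairs_def
proof (rule wp_For[where N = "min m (k - b)" and K = "80 + emit_time" and
    I = "\<lambda>j mem' out'. same ({2} \<union> - work) mem mem' \<and> sink (found b s j) mem' out'"], goal_cases)
  case 2
  have "sink (found b s 0) (mem(2 := 0)) out" by (rule sink_same[OF sink]) auto
  then show ?case by simp
next
  case 5
  show ?case using size_less(2) by (simp add: min_less_iff_disj)
next
  case (7 j mem' out')
  then show ?case using b by simp
next
  case (8 j t0 mem0 out0)
  let ?u = "fst (ps ! (b + j))" and ?v = "snd (ps ! (b + j))"
  have j: "j < m" "b + j < k" using 8(1) by auto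
  have st: "same ({2} \<union> - work) mem mem0" "mem0 2 = j" and sink0: "sink (found b s j) mem0 out0"
    using 8 by auto
  have cells: "mem0 4 = b" "mem0 6 = s" using st b s by auto
  have pr: "mem0 (adr 4 j) = rep ?u" "mem0 (adr 5 j) = rep ?v"
    using st pairs 8(1) by (auto simp: pairs_at_def)
  have lb: "mem0 (adr 3 (rep v)) = L v" for v using st lab(2) by simp
  have less: "L v < W" "j < W" for v
    using bounded_less[OF 8(2), of "adr 3 (rep v)"] bounded_less[OF 8(2), of 2] lb st by auto
  note iff = answers_iff_labels[OF lab(1) s(2) j(2)]
  note facts = 8(2) st cells pr lb less j
  have skip: "sink (found b s (Suc j)) (mem0(2 := Suc j)) out0" if "(b + j, s) \<notin> answers"
    using that sink_same[OF sink0, of "mem0(2 := Suc j)"] j by (simp add: found_Suc)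
  show ?case
  proof (cases "(b + j, s) \<in> answers")
    case False
    from skip[OF False] False show ?thesis using facts by (auto simp: iff)
  next
    case True
    have em: "wp emit mem0 out0 t' (\<lambda>t'' mem' out'. t'' \<le> t' + emit_time \<and> same (- work) mem0 mem' \<and>
        sink (found b s (Suc j)) mem' out')" for t'
      using emit[OF 8(2) sink0 _ cells(2) j(2) s(2) found_fresh] True cells st
      by (simp add: found_Suc j)
    have "wp emit mem0 out0 t' (\<lambda>t'' mem' out'. t'' \<le> t' + emit_time \<and> mem' 2 = j \<and>
        same ({2} \<union> - work) mem (mem'(2 := Suc j)) \<and> sink (found b s (Suc j)) (mem'(2 := Suc j)) out')" for t'
    proof (rule wp_mono[OF em[of t']], goal_cases)
      case (1 t'' mem' out')
      then show ?case using sink_same[of _ mem' out' "mem'(2 := Suc j)"] st by auto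
    qed
    \<comment> \<open>The three nested tests cost 13, 13 and 52 steps.\<close>
    then have "wp emit mem0 out0 (78 + t0) (\<lambda>t'' mem' out'. t'' \<le> t0 + (80 + emit_time) \<and> mem' 2 = j \<and>
        same ({2} \<union> - work) mem (mem'(2 := Suc j)) \<and> sink (found b s (Suc j)) (mem'(2 := Suc j)) out')"
      by (rule wp_mono) auto
    then show ?thesis using True facts by (simp add: iff)
  qed
next
  case (9 t' mem' out')
  have "min m (k - b) * (80 + emit_time + 21) \<le> m * (80 + emit_time + 21)" by (rule mult_le_mono1) simp
  then have "t' \<le> t + (120 + emit_time) * m" using 9(2) m_gt by (simp add: algebra_simps)
  then show ?case using 9 by (auto intro!: post simp: found_next_source)
qed (use bd in auto)

lemma wp_batch_junctions:
  assumes bd: "bounded mem" and b: "mem 4 = b" and reps: "reps mem" and ord: "arc_order {..<m} ts mem"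
    and pairs: "pairs_at b mem" and sink: "sink (found b 0 0) mem out"
    and post: "\<And>t' mem' out'. bounded mem' \<Longrightarrow> t' \<le> t + (700 + emit_time) * (n * m) \<Longrightarrow>
      same ({6, 2, 3} \<union> arr 3 \<union> - work) mem mem' \<Longrightarrow> sink (found b n 0) mem' out' \<Longrightarrow> Q t' mem' out'"
  shows "wp (batch_junctions emit) mem out t Q"
  unfolding batch_junctions_def
proof (rule wp_For[where N = n and K = "(600 + emit_time) * m" and
    I = "\<lambda>s mem' out'. same ({6, 2, 3} \<union> arr 3 \<union> - work) mem mem' \<and> sink (found b s 0) mem' out'"], goal_cases)
  case 2
  have "sink (found b 0 0) (mem(6 := 0)) out" by (rule sink_same[OF sink]) auto
  then show ?case by simp
next
  case (8 s t0 mem0 out0)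
  note outer = this
  have st0: "same ({6, 2, 3} \<union> arr 3 \<union> - work) mem mem0" "mem0 6 = s" using 8 by auto
  have sink0: "sink (found b s 0) mem0 out0" using 8 by auto
  have s_less: "Suc s < W" using 8(1) W_ge by simp
  show ?case
  proof (simp only: wp_Seq, rule wp_find_rep, goal_cases)
    case (2 t1 mem1)
    have st1: "same ({6, 2, 3} \<union> arr 3 \<union> - work) mem mem1" "mem1 6 = s" "mem1 3 = rep s"
      using 2 st0 by auto
    have sink1: "sink (found b s 0) mem1 out0" by (rule sink_same_subset[OF sink0 2(3)]) simp
    show ?case
    proof (cases "s \<in> set E")
      case False
      have "sink (found b (Suc s) 0) (mem1(6 := Suc s)) out0"
        using sink_same[OF sink1, of "mem1(6 := Suc s)"] by (simp add: found_isolated[OF False])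
      moreover have "10 + t1 \<le> t0 + (600 + emit_time) * m"
        using 2(2) m_gt by (simp add: add_mult_distrib)
      ultimately show ?thesis using 2(1) st1 rep_notin[OF False] by simp
    next
      case True
      have "wp clear_labels mem1 out0 (t1 + 9) (\<lambda>t'' mem'' out''.
          wp (Seq (Store (Adr 3 (Var 3)) (Plus (Var 6) (Const 1))) (Seq set_labels (test_pairs emit))) mem'' out'' t''
          (\<lambda>t' mem' out'. t' \<le> t0 + (600 + emit_time) * m \<and> mem' 6 = s \<and>
            same ({6, 2, 3} \<union> arr 3 \<union> - work) mem (mem'(6 := Suc s)) \<and>
            sink (found b (Suc s) 0) (mem'(6 := Suc s)) out'))"
      proof (rule wp_clear_labels[OF 2(1)], goal_cases)
        case (1 t2 mem2)
        let ?mem3 = "mem2(adr 3 (rep s) := Suc s)"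
        have cells2: "mem2 6 = s" "mem2 3 = rep s" using 1 st1 by auto
        have same2: "same ({6, 2, 3} \<union> arr 3 \<union> - work) mem mem2" using 1(3) st1(1) by simp
        have same3: "same ({6, 2, 3} \<union> arr 3 \<union> - work) mem ?mem3" using same2 by auto
        have bd3: "bounded ?mem3" using 1(1) s_less by (simp add: bounded_def)
        have sink3: "sink (found b s 0) ?mem3 out0"
          by (rule sink_same[OF sink_same_subset[OF sink1 1(3)]]) (auto simp: arr_work)
        have "wp set_labels ?mem3 out0 (t2 + 11) (\<lambda>t'' mem'' out''. wp (test_pairs emit) mem'' out'' t''
          (\<lambda>t' mem' out'. t' \<le> t0 + (600 + emit_time) * m \<and> mem' 6 = s \<and>
            same ({6, 2, 3} \<union> arr 3 \<union> - work) mem (mem'(6 := Suc s)) \<and>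
            sink (found b (Suc s) 0) (mem'(6 := Suc s)) out'))"
        proof (rule wp_set_labels[OF bd3, where s = s and ts = ts], goal_cases)
          case 1
          show ?case by (rule reps_same[OF reps]) (use same2 in auto)
        next
          case 2
          have "i \<le> 2 * m" if "i < length ts" for i
            using that arc_order_length[OF ord] by simp
          then show ?case by (intro arc_order_cong[OF ord]) (use same2 in auto)
        next
          case (5 v)
          show ?case using rep_eq_iff[OF True, of v] 1(4) by auto
        next
          case (6 t4 mem4 L)
          note labels = this
          have same4: "same ({6, 2, 3} \<union> arr 3 \<union> - work) mem mem4" using labels(3) same3 by simp
          show ?case
          proof (rule wp_test_pairs[OF labels(1), where b = b and s = s and L = L], goal_cases)
            case 4
            show ?case using pairs same4 by (auto simp: pairs_at_def)
          next
            case 7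
            show ?case by (rule sink_same_subset[OF sink3 labels(3)]) (simp add: arr_work)
          next
            case (8 t5 mem5 out5)
            have "t5 \<le> t0 + (600 + emit_time) * m"
              using 8(2) labels(2) 1(2) 2(2) m_gt by (simp add: algebra_simps)
            moreover have "sink (found b (Suc s) 0) (mem5(6 := Suc s)) out5"
              by (rule sink_same[OF 8(4)]) auto
            ultimately show ?case using 8(3) same4 labels(3) cells2 by auto
          qed (use same2 same4 b labels cells2 outer in auto)
        qed (use cells2 outer in auto)
        then show ?case using cells2 s_less 1(1) by simp
      qed
      moreover have "2 * m - rep s < W" using size_less(3) by (rule le_less_trans[OF diff_le_self])
      ultimately show ?thesis using rep_in[OF True] st1 2(1) by simp
    qed
  qed (use outer in auto)
next
  case (9 t' mem' out')
  have "t' \<le> t + (700 + emit_time) * (n * m)"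
    by (rule time_le[OF 9(2)]) simp
  then show ?case using 9 post by blast
qed (use bd in auto)

text \<open>The array of heights must start at zero for relaxation; scalar cells are exempt because
  preparing the answer table uses a loop counter among them. The number of rounds is
  \<open>k / m\<close> rounded up.\<close>

lemma wp_all_junctions:
  assumes bd: "bounded mem" and zero: "\<And>a. a \<in> work \<Longrightarrow> mem a = 0 \<or> a < 10"
    and sink: "sink {} mem out"
    and post: "\<And>t' mem' out'. t' \<le> t + (2000 + emit_time) * (n * (m + k)) \<Longrightarrow>
      sink answers mem' out' \<Longrightarrow> Q t' mem' out'"
  shows "wp (all_junctions emit) mem out t Q"
proof -
  let ?N = "(k + m - 1) div m"
  have N: "j < ?N \<longleftrightarrow> j * m < k" for j
  proof -
    have "j < ?N \<longleftrightarrow> Suc j * m \<le> k + m - 1"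
      using m_gt by (simp add: Suc_le_eq[symmetric] less_eq_div_iff_mult_less_eq del: mult_Suc)
    then show ?thesis using m_gt by auto
  qed
  show ?thesis
    unfolding all_junctions_def wp_Seq
  proof (rule wp_arc_reps[OF bd], goal_cases)
    case (1 t1 mem1)
    note p1 = this
    have sink1: "sink {} mem1 out" by (rule sink_same_subset[OF sink p1(3)]) (simp add: arr_work)
    have reps1: "reps mem1" by (rule repsI) (use p1 in simp)
    show ?case
    proof (rule wp_levels[OF p1(1) reps1], goal_cases)
      case (1 p)
      moreover have "\<not> adr 6 p < 10" by (simp add: adr_def)
      ultimately show ?case using p1(3) zero[of "adr 6 p"] by simp
    next
      case (2 t2 mem2)
      note p2 = this
      have sink2: "sink {} mem2 out" by (rule sink_same_subset[OF sink1 p2(3)]) (simp add: arr_work)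
      have reps2: "reps mem2" by (rule reps_same[OF reps1]) (use p2(3) in auto)
      show ?case
      proof (rule wp_sort_arcs[OF p2(1) reps2], goal_cases)
        case 1
        then show ?case using p2(4) .
      next
        case (2 t3 mem3 ts)
        note p3 = this
        have sink3: "sink {} mem3 out" by (rule sink_same_subset[OF sink2 p3(3)]) (simp add: arr_work)
        have reps3: "reps mem3" by (rule reps_same[OF reps2]) (use p3(3) in auto)
        have len: "length ts \<le> m" using arc_order_length[OF p3(4)] by simp
        \<comment> \<open>Preprocessing takes 300, 200 and 200 times \<open>n * m\<close>, plus 3
          steps for clearing cell 4. A batch takes 400 and \<open>700 + emit_time\<close> times
          \<open>n * m\<close>; the remaining 100 absorb its loop overhead.\<close>
        let ?J = "\<lambda>j t' mem' out'. mem' 4 = j * m \<and> reps mem' \<and> arc_order {..<m} ts mem' \<and>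
          sink (found (j * m) 0 0) mem' out' \<and>
          t' \<le> t + 703 * (n * m) + j * ((1200 + emit_time) * (n * m))"
        have "wp (While (Minus Kv (Var 4))
            (Seq pair_reps (Seq (batch_junctions emit) (Store (Const 4) (Plus (Var 4) Mv)))))
            (mem3(4 := 0)) out (t3 + 3) Q"
        proof (rule wp_While[where N = ?N and I = ?J], goal_cases)
          case 1
          then show ?case using p3(1) by (simp add: bounded_def)
        next
          case 2
          have "reps (mem3(4 := 0))" by (rule reps_same[OF reps3]) simp
          moreover have "arc_order {..<m} ts (mem3(4 := 0))" by (rule arc_order_cong[OF p3(4)]) auto
          moreover have "sink {} (mem3(4 := 0)) out" by (rule sink_same[OF sink3]) auto
          moreover have "t3 + 3 \<le> t + 703 * (n * m)" using p1(2) p2(2) p3(2) nm_pos(1) by linarith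
          ultimately show ?case by (simp add: found_start)
        next
          case (3 j t' mem' out')
          have "k - mem' 4 < W" using size_less(5) by (rule le_less_trans[OF diff_le_self])
          moreover have J: "mem' 4 = j * m" using 3(3) by blast
          moreover have "j = ?N \<longleftrightarrow> k \<le> j * m" using 3(1) N[of j] by auto
          ultimately show ?case using bounded_less[OF 3(2), of 4] by simp
        next
          case (4 j t' mem' out')
          then have J: "mem' 4 = j * m" "reps mem'" "arc_order {..<m} ts mem'"
            "sink (found (j * m) 0 0) mem' out'"
            "t' \<le> t + 703 * (n * m) + j * ((1200 + emit_time) * (n * m))" by auto
          have jm: "j * m < k" using 4(1) N by blast
          show ?case
            unfolding wp_Seq
          proof (rule wp_pair_reps[OF 4(2) J(1)], goal_cases)
            case (1 t4 mem4)
            note p4 = this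
            have b4: "mem4 4 = j * m" using J p4(3) by simp
            have reps4: "reps mem4" by (rule reps_same[OF J(2)]) (use p4(3) in auto)
            have ord4: "arc_order {..<m} ts mem4" by (rule arc_order_cong[OF J(3)]) (use p4(3) in auto)
            have sink4: "sink (found (j * m) 0 0) mem4 out'"
              by (rule sink_same_subset[OF J(4) p4(3)]) (simp add: arr_work)
            show ?case
            proof (rule wp_batch_junctions[OF p4(1) b4 reps4 ord4 p4(4) sink4], goal_cases)
              case (1 t5 mem5 out5)
              note p5 = this
              have b5: "mem5 4 = j * m" using b4 p5(3) by simp
              have len': "i \<le> 2 * m" if "i < length ts" for i using that len by simp
              have "reps (mem5(4 := Suc j * m))"
                by (rule reps_same[OF reps4]) (use p5(3) in auto)
              moreover have "arc_order {..<m} ts (mem5(4 := Suc j * m))"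
                by (rule arc_order_cong[OF ord4]) (use p5(3) len' in auto)
              moreover have "sink (found (Suc j * m) 0 0) (mem5(4 := Suc j * m)) out5"
                using sink_same[OF p5(4), of "mem5(4 := Suc j * m)"] found_next_batch[of "j * m"]
                by (simp add: add.commute)
              moreover have "t5 + 8 \<le> t + 703 * (n * m) + Suc j * ((1200 + emit_time) * (n * m))"
              proof -
                have "Suc j * ((1200 + emit_time) * (n * m)) =
                    j * ((1200 + emit_time) * (n * m)) + (700 + emit_time) * (n * m) + 500 * (n * m)"
                  by (simp add: add_mult_distrib)
                moreover have "t4 \<le> t' + 6 + 400 * (n * m)" using p4(2) by simp
                ultimately show ?thesis using p5(2) J(5) nm_pos(1) by linarith
              qed
              moreover have "j * m + m < W" using jm W_ge by simp
              ultimately show ?case using b5 p5(1) by (simp add: add.commute)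
            qed
          qed
        next
          case (5 t' mem' out')
          then have J: "sink (found (?N * m) 0 0) mem' out'"
            "t' \<le> t + 703 * (n * m) + ?N * ((1200 + emit_time) * (n * m))" by auto
          have "k \<le> ?N * m" using N[of ?N] by simp
          then have "sink answers mem' out'" using J(1) by (simp add: found_all)
          moreover have "t' + 6 \<le> t + (2000 + emit_time) * (n * (m + k))"
          proof -
            \<comment> \<open>Rounding up adds less than one full batch, that is fewer than
              \<open>m\<close> pairs, which the summand \<open>m\<close> of the time bound pays
              for.\<close>
            have "?N * m \<le> m + k" using div_times_less_eq_dividend[of "k + m - 1" m] by linarith
            then have "(1200 + emit_time) * (n * (?N * m)) \<le> (1200 + emit_time) * (n * (m + k))"
              by (intro mult_le_mono2)
            moreover have "n * m \<le> n * (m + k)" by simp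
            moreover have "(2000 + emit_time) * (n * (m + k)) =
                (1200 + emit_time) * (n * (m + k)) + 800 * (n * (m + k))"
              by (simp add: add_mult_distrib)
            moreover have "?N * ((1200 + emit_time) * (n * m)) = (1200 + emit_time) * (n * (?N * m))"
              by (simp only: mult.assoc mult.left_commute)
            ultimately show ?thesis using J(2) nm_pos(1) by linarith
          qed
          ultimately show ?case by (intro post) simp_all
        qed
        then show ?case using p3(1) by (simp add: numeral_3_eq_3)
      qed
    qed
  qed
qed

end

section \<open>Printing and storing the answers\<close>

definition print_answer :: prog where
  "print_answer = Seq (Output (Plus (Var 4) (Var 2))) (Output (Var 6))"

definition printed :: "(nat \<times> nat) set \<Rightarrow> memory \<Rightarrow> nat list \<Rightarrow> bool" where
  "printed X mem out \<longleftrightarrow> (\<exists>xs. out = flatten xs \<and> distinct xs \<and> set xs = X)"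

lemma flatten_snoc: "flatten (xs @ [(a, b)]) = flatten xs @ [a, b]"
  by (simp add: flatten_def)

lemma printed_insert:
  assumes "printed X mem out" "(i, s) \<notin> X"
  shows "printed (insert (i, s) X) mem' (out @ [i, s])"
proof -
  obtain xs where "out = flatten xs" "distinct xs" "set xs = X"
    using assms(1) by (auto simp: printed_def)
  with assms(2) show ?thesis
    unfolding printed_def by (intro exI[of _ "xs @ [(i, s)]"]) (simp add: flatten_snoc)
qed

lemma (in instance_ram) junction_ram_print: "junction_ram W S n es ps m k G print_answer 9 printed"
proof unfold_locales
  fix X mem out mem' i s t
  assume "bounded mem" "printed X mem out" "mem 4 + mem 2 = i" "mem 6 = s" "i < k" "s < n" "(i, s) \<notin> X"
  then show "wp print_answer mem out t (\<lambda>t' mem' out'. t' \<le> t + 9 \<and> same (- work) mem mem' \<and>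
      printed (insert (i, s) X) mem' out')"
    using printed_insert[of X mem out i s] less_trans[OF _ size_less(5)] bounded_less[of mem]
    by (auto simp: print_answer_def)
qed (simp add: printed_def)

text \<open>Here \<open>a\<close> and \<open>b\<close> are the addresses of the start word and the
  length word of the current pair: append at start plus length, then increase the length.\<close>

definition store_answer :: prog where
  "store_answer =
     (let a = Plus (Var 0) (Times (Const 2) (Plus (Var 4) (Var 2))); b = Plus a (Const 1) in
       Seq (Store (Plus (Cell a) (Cell b)) (Var 6)) (Store b (Plus (Cell b) (Const 1))))"

text \<open>Every pair receives a block of \<open>n\<close> cells behind the table, enough for all
  its junctions. Only start words are written; the length words are 0 from the beginning.\<close>

definition init_table :: prog where
  "init_table = Seq (Store (Const 0) (Plus (Const 17) (Times (Const 14) Mv)))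
     (For 6 Kv (Store (Plus (Var 0) (Times (Const 2) (Var 6)))
       (Plus (Plus (Var 0) (Times (Const 2) Kv)) (Times Nv (Var 6)))))"

locale store_ram = instance_ram +
  assumes S_table: "17 + 14 * m + 2 * k + n * k \<le> S" and W_table: "17 + 14 * m + 2 * k + n * k < W"
begin

definition "table = 17 + 14 * m"
definition "start i = table + 2 * k + n * i"

definition stored :: "(nat \<times> nat) set \<Rightarrow> memory \<Rightarrow> nat list \<Rightarrow> bool" where
  "stored X mem out \<longleftrightarrow> mem 0 = table \<and> X \<subseteq> {..<k} \<times> {..<n} \<and>
     (\<forall>i<k. mem (table + 2 * i) = start i \<and>
       distinct (map mem [start i..<start i + mem (table + 2 * i + 1)]) \<and>
       set (map mem [start i..<start i + mem (table + 2 * i + 1)]) = {s. (i, s) \<in> X})"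

lemma not_work: "a \<notin> work \<longleftrightarrow> a = 0 \<or> table \<le> a"
  by (auto simp: work_def table_def)

lemma stored_cong:
  assumes "stored X mem out" "same work mem mem'" shows "stored X mem' out"
proof -
  have eq: "mem' 0 = mem 0" "\<And>a. table \<le> a \<Longrightarrow> mem' a = mem a"
    using assms(2) not_work by blast+
  have "map mem' [start i..<r] = map mem [start i..<r]" for i r
    by (rule map_cong) (auto simp: eq start_def)
  then show ?thesis
    using assms(1) by (simp add: stored_def eq del: set_map map_eq_conv)
qed

lemma start_Suc_le: "i < j \<Longrightarrow> start i + n \<le> start j"
  using mult_le_mono2[of "Suc i" j n] by (simp add: start_def)

lemma start_le: "i < k \<Longrightarrow> start i + n \<le> table + 2 * k + n * k"
  using mult_le_mono2[of "Suc i" k n] by (simp add: start_def)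

lemma stored_length:
  assumes "stored X mem out" "i < k"
  shows "mem (table + 2 * i + 1) = card {s. (i, s) \<in> X}"
  using assms distinct_card[of "map mem [start i..<start i + mem (table + 2 * i + 1)]"]
  by (simp add: stored_def)

lemma answers_card_le: "X \<subseteq> {..<k} \<times> {..<n} \<Longrightarrow> card {s. (i, s) \<in> X} \<le> n"
  using card_mono[of "{..<n}" "{s. (i, s) \<in> X}"] by auto

text \<open>The stored length is a cardinality. As \<open>s\<close> is a new vertex below
  \<open>n\<close>, the old length is less than \<open>n\<close>, so the write stays inside the
  block of pair \<open>i\<close>.\<close>

lemma stored_insert:
  assumes st: "stored X mem out" and i: "i < k" "s < n" "(i, s) \<notin> X"
  defines "l \<equiv> mem (table + 2 * i + 1)"
  shows "l < n" "stored (insert (i, s) X) (mem(start i + l := s, table + 2 * i + 1 := Suc l)) out"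
proof -
  have X: "X \<subseteq> {..<k} \<times> {..<n}" using st by (simp add: stored_def)
  have "finite {s. (i, s) \<in> X}" by (rule finite_subset[of _ "{..<n}"]) (use X in auto)
  moreover have "card (insert s {s. (i, s) \<in> X}) \<le> n"
    using card_mono[of "{..<n}" "insert s {s. (i, s) \<in> X}"] X i(2) by auto
  ultimately show l: "l < n" using stored_length[OF st i(1)] i(3) by (simp add: l_def)
  let ?mem = "mem(start i + l := s, table + 2 * i + 1 := Suc l)"
  have len: "mem (table + 2 * j + 1) \<le> n" if "j < k" for j
    using stored_length[OF st that] answers_card_le[OF X] by simp
  have entries: "?mem (table + 2 * j) = mem (table + 2 * j)"
      "?mem (table + 2 * j + 1) = (if j = i then Suc l else mem (table + 2 * j + 1))" if "j < k" for j
    using that i(1) by (auto simp: start_def) presburger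
  have old: "map ?mem [start j..<start j + r] = map mem [start j..<start j + r]"
    if "j < k" "r \<le> n" "j \<noteq> i \<or> r \<le> l" for j r
  proof (rule map_cong)
    fix a assume a: "a \<in> set [start j..<start j + r]"
    have "a \<noteq> start i + l"
      \<comment> \<open>Blocks of different pairs are disjoint, and within its own block the new
        entry lies behind the old ones.\<close>
      using a that start_Suc_le[of i j] start_Suc_le[of j i] l by (cases i j rule: linorder_cases) auto
    moreover have "a \<noteq> table + 2 * i + 1" using a i(1) by (auto simp: start_def)
    ultimately show "?mem a = mem a" by simp
  qed simp
  have new: "map ?mem [start i..<start i + Suc l] = map mem [start i..<start i + l] @ [s]"
    using old[OF i(1), of l] l i(1) by (simp add: start_def)
  have "distinct (map ?mem [start j..<start j + ?mem (table + 2 * j + 1)]) \<and>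
      set (map ?mem [start j..<start j + ?mem (table + 2 * j + 1)]) = {s'. (j, s') \<in> insert (i, s) X}"
    if j: "j < k" for j
  proof (cases "j = i")
    case True
    then show ?thesis unfolding entries(2)[OF j] using st i new
      by (auto simp: stored_def l_def simp del: set_map upt_Suc)
  next
    case False
    then show ?thesis unfolding entries(2)[OF j] using st old[OF j len[OF j]] j
      by (simp add: stored_def del: set_map map_eq_conv fun_upd_apply)
  qed
  moreover have "?mem 0 = table" using st by (simp add: stored_def start_def table_def)
  moreover have "insert (i, s) X \<subseteq> {..<k} \<times> {..<n}" using X i by simp
  ultimately show "stored (insert (i, s) X) ?mem out"
    using st entries(1) unfolding stored_def by simp
qed

lemma junction_ram_store: "junction_ram W S n es ps m k G store_answer 60 stored"
proof unfold_locales
  fix X mem out i s t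
  assume *: "bounded mem" "stored X mem out" "mem 4 + mem 2 = i" "mem 6 = s" "i < k" "s < n" "(i, s) \<notin> X"
  let ?l = "mem (Suc (table + 2 * i))"
  have ins: "?l < n" "stored (insert (i, s) X) (mem(start i + ?l := s, Suc (table + 2 * i) := Suc ?l)) out'" for out'
    using stored_insert[OF *(2,5-7)] by (simp_all add: stored_def)
  have addr: "mem 0 = table" "mem (table + 2 * i) = start i" using *(2,5) by (auto simp: stored_def)
  have lim: "start i + ?l < table + 2 * k + n * k" "Suc (table + 2 * i) < table + 2 * k + n * k + 1"
    using start_le[OF *(5)] ins(1) *(5) by simp_all
  have less: "mem 4 < W" "mem 2 < W" "s < W" "start i < W" "?l < W" "Suc ?l < W" "i < W" "2 * i < W"
    "table < W" "table + 2 * i < W" "Suc (table + 2 * i) < W" "start i + ?l < W"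
    "table + 2 * i < S" "Suc (table + 2 * i) < S" "start i + ?l < S"
    using bounded_less[OF *(1)] lim ins(1) S_table W_table W_ge *(3,5,6) by (simp_all add: table_def)
  have neq: "0 < start i" "start i + ?l \<noteq> 0" "start i + ?l \<noteq> 4" "start i + ?l \<noteq> 2" "start i + ?l \<noteq> Suc (table + 2 * i)"
    using *(5) by (simp_all add: start_def table_def)
  have "start i + ?l \<notin> work" "Suc (table + 2 * i) \<notin> work"
    by (simp_all add: not_work start_def)
  then show "wp store_answer mem out t (\<lambda>t' mem' out'. t' \<le> t + 60 \<and> same (- work) mem mem' \<and>
      stored (insert (i, s) X) mem' out')"
    using ins(2) addr less neq *(3,4)
    by (simp add: store_answer_def Let_def del: distrib_left_numeral)
qed (rule stored_cong)

text \<open>All blocks are empty, so this establishes the sink for no answers. The exception for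
  cells below 10 is due to the counter in cell 6, which ends as \<open>k\<close>.\<close>

lemma wp_init_table:
  assumes post: "\<And>t' mem'. bounded mem' \<Longrightarrow> t' \<le> t + 60 * (n * (m + k)) \<Longrightarrow> stored {} mem' [] \<Longrightarrow>
      (\<forall>a\<in>work. mem' a = 0 \<or> a < 10) \<Longrightarrow> Q t' mem' []"
  shows "wp init_table (\<lambda>_. 0) [] t Q"
proof -
  let ?mem = "(\<lambda>_. 0)(0 := table)"
  have lim: "table < W" "2 * k < W" "table + 2 * k < W" "n * k < W" "table + 2 * k + n * k < W"
      "table + 2 * k + n * k \<le> S" "14 * m < W" "14 < W" "17 < W" "0 < S"
    using W_table S_table W_ge by (simp_all add: table_def)
  have "wp (For 6 Kv (Store (Plus (Var 0) (Times (Const 2) (Var 6)))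
       (Plus (Plus (Var 0) (Times (Const 2) Kv)) (Times Nv (Var 6))))) ?mem [] (t + 8) Q"
  proof (rule wp_For[where N = k and K = 30 and
      I = "\<lambda>j mem' out'. out' = [] \<and>
        (\<forall>a. a \<noteq> 6 \<longrightarrow> mem' a = (if a = 0 then table
           else if \<exists>i<j. a = table + 2 * i then start ((a - table) div 2) else 0))"], goal_cases)
    case 1
    then show ?case using lim by (simp add: bounded_def)
  next
    case (8 j t0 mem0 out0)
    have st: "mem0 0 = table" "mem0 6 = j" "out0 = []" using 8 by simp_all
    have j: "2 * j < W" "j < W" "table + 2 * j < W" "table + 2 * j < S" "n * j < W"
      "start j < W" "table + 2 * k + n * j < W"
      using lim 8(1) start_le[OF 8(1)] n_pos mult_le_mono2[of j k n] by (simp_all add: start_def)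
    have "\<forall>a. a \<noteq> 6 \<longrightarrow> (mem0(table + 2 * j := start j, 6 := Suc j)) a = (if a = 0 then table
        else if \<exists>i<Suc j. a = table + 2 * i then start ((a - table) div 2) else 0)"
      using 8(3) by (auto simp: less_Suc_eq table_def)
    moreover have "table + 2 * j \<noteq> 6" by (simp add: table_def)
    ultimately show ?case
      using 8(2) st j lim by (simp add: start_def)
  next
    case (9 t' mem' out')
    have cell: "mem' a = (if a = 0 then table
           else if \<exists>i<k. a = table + 2 * i then start ((a - table) div 2) else 0)" if "a \<noteq> 6" for a
      using 9(4) that by blast
    have "1 * (m + k) \<le> n * (m + k)" using n_pos by (intro mult_le_mono1) simp
    then have "t' \<le> t + 60 * (n * (m + k))"
    proof -
      have "t' \<le> t + 42 * k + 17" using 9(2) by simp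
      moreover have "m + k \<le> n * (m + k)" using \<open>1 * (m + k) \<le> _\<close> by (simp only: mult_1)
      ultimately show ?thesis using m_gt by linarith
    qed
    moreover have "stored {} mem' []"
    proof -
      have "mem' 0 = table" using cell[of 0] by simp
      moreover have "mem' (table + 2 * i) = start i" "mem' (table + 2 * i + 1) = 0" if "i < k" for i
      proof -
        show "mem' (table + 2 * i) = start i" using that by (subst cell) (auto simp: table_def)
        have "table + 2 * i + 1 \<noteq> table + 2 * i'" for i' by presburger
        then show "mem' (table + 2 * i + 1) = 0" by (subst cell) (auto simp: table_def)
      qed
      ultimately show ?thesis by (simp add: stored_def)
    qed
    moreover have "mem' a = 0 \<or> a < 10" if "a \<in> work" for a
      using that by (cases "a = 6") (auto simp: cell work_def table_def)
    ultimately show ?case using 9(1,4) post by simp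
  qed (use lim in auto)
  moreover have eq: "Suc (Suc (Suc (Suc (Suc (Suc (Suc (Suc t))))))) = t + 8" by simp
  ultimately show ?thesis using lim by (simp add: init_table_def table_def eq)
qed

end

section \<open>Graphs without arcs, and assembly of the two programs\<close>

lemma junctions_of_arcless:
  assumes "is_instance G n [] ps" shows "junctions_of G p = {}"
proof -
  have trivial: "pre_digraph.awalk (with_proj G) s q u \<Longrightarrow> s = u" for s q u
    using assms by (cases q) (auto simp: is_instance_def pre_digraph.awalk_def pre_digraph.cas.simps)
  then show ?thesis
    by (auto simp: junctions_of_def pre_digraph.junction_def pre_digraph.apath_def dest!: trivial split: prod.split)
qed

text \<open>Without arcs a nonempty list of pairs would keep the batch loop running forever, as cell
  4 advances by \<open>m\<close>; the correct result is then empty anyway.\<close>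

definition print_junctions :: prog where
  "print_junctions = If Mv (all_junctions print_answer) Skip"

definition store_junctions :: prog where
  "store_junctions = If Mv (Seq init_table (all_junctions store_answer)) Skip"

text \<open>As \<open>N\<close> is at least 2, the factor \<open>N ^ 5\<close> is at least 32 and
  pays for all constants; the other two powers are for the product \<open>n * k\<close> in the
  storage size.\<close>

lemma word_bound:
  fixes n m k :: nat
  defines "N \<equiv> n + m + k + 2"
  shows "20 * N \<le> N ^ 7" "17 + 14 * m + 2 * k + n * k < N ^ 7"
proof -
  have "2 ^ 5 * N \<le> N ^ 5 * N" by (intro mult_le_mono1 power_mono) (simp_all add: N_def)
  also have "\<dots> \<le> N ^ 5 * N * N" by (simp add: N_def)
  also have "\<dots> = N ^ 7" by (simp add: eval_nat_numeral)
  finally show "20 * N \<le> N ^ 7" by simp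
  have "2 ^ 5 * (N * N) \<le> N ^ 5 * (N * N)" by (intro mult_le_mono1 power_mono) (simp_all add: N_def)
  also have "\<dots> = N ^ 7" by (simp add: eval_nat_numeral)
  finally have "32 * (N * N) \<le> N ^ 7" by simp
  moreover have "n * k \<le> N * N" by (intro mult_le_mono) (simp_all add: N_def)
  moreover have "2 * N \<le> N * N" by (intro mult_le_mono1) (simp add: N_def)
  moreover have "17 + 14 * m + 2 * k < 17 * N" by (simp add: N_def)
  ultimately show "17 + 14 * m + 2 * k + n * k < N ^ 7" by linarith
qed

lemma instance_ramI:
  fixes n :: nat and es ps :: "(nat \<times> nat) list"
  assumes "is_instance G n es ps" "es \<noteq> []" "17 + 14 * length es \<le> S"
  shows "instance_ram ((n + length es + length ps + 2) ^ 7) S n es ps (length es) (length ps) G"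
  using assms word_bound(1)[of n "length es" "length ps"]
  by unfold_locales simp_all

lemma fits_Mv:
  "fits ((n + length es + length ps + 2) ^ 7) S (input n es ps) mem Mv"
  "val (input n es ps) mem Mv = length es"
  using word_bound(1)[of n "length es" "length ps"]
  by (simp_all add: Mv_def input_header length_input)

lemma (in instance_ram) bounded_zero: "bounded (\<lambda>_. 0)"
  by (simp add: bounded_def)

lemma (in instance_ram) wp_print_junctions:
  "wp print_junctions (\<lambda>_. 0) [] 0
    (\<lambda>t mem out. t \<le> 2100 * (n * (m + k) + 1) \<and> prints_junctions G ps (mem, out))"
proof -
  interpret junction_ram W S n es ps m k G print_answer 9 printed
    by (rule junction_ram_print)
  have "wp (all_junctions print_answer) (\<lambda>_. 0) [] 3
    (\<lambda>t mem out. t \<le> 2100 * (n * (m + k) + 1) \<and> prints_junctions G ps (mem, out))"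
  proof (rule wp_all_junctions[OF bounded_zero], goal_cases)
    case 2
    show ?case by (simp add: printed_def flatten_def)
  next
    case (3 t mem out)
    then show ?case
      by (simp add: prints_junctions_def printed_def answers_def flip: k_def)
  qed simp
  then show ?thesis using m_gt by (simp add: print_junctions_def numeral_3_eq_3)
qed

lemma (in store_ram) wp_store_junctions:
  "wp store_junctions (\<lambda>_. 0) [] 0
    (\<lambda>t mem out. t \<le> 2200 * (n * (m + k) + 1) \<and> stores_junctions S G ps (mem, out))"
proof -
  interpret junction_ram W S n es ps m k G store_answer 60 stored
    by (rule junction_ram_store)
  have fin: "stores_junctions S G ps (mem, out)" if st: "stored answers mem out" for mem out
  proof -
    have end_le: "start i + mem (table + 2 * i + 1) \<le> S" if "i < k" for i
    proof -
      have "answers \<subseteq> {..<k} \<times> {..<n}" using answers_less by auto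
      then have "mem (table + 2 * i + 1) \<le> n"
        using stored_length[OF st that] answers_card_le[of answers i] by simp
      moreover have "start i + n \<le> S"
        using start_le[OF that] S_table unfolding table_def by (rule order_trans)
      ultimately show ?thesis by linarith
    qed
    have "table + 2 * k \<le> S" using S_table by (simp add: table_def)
    moreover have "{s. (i, s) \<in> answers} = junctions_of G (ps ! i)" if "i < k" for i
      using that by (auto simp: answers_def)
    ultimately show ?thesis
      using st end_le unfolding stores_junctions_def stored_def Let_def
      by (auto simp flip: k_def simp del: set_map)
  qed
  have "wp init_table (\<lambda>_. 0) [] 3 (\<lambda>t mem out. wp (all_junctions store_answer) mem out t
    (\<lambda>t mem out. t \<le> 2200 * (n * (m + k) + 1) \<and> stores_junctions S G ps (mem, out)))"
  proof (rule wp_init_table, goal_cases)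
    case (1 t1 mem1)
    show ?case
    proof (rule wp_all_junctions[OF 1(1) _ 1(3)], goal_cases)
      case (1 a)
      then show ?case using \<open>\<forall>a\<in>work. mem1 a = 0 \<or> a < 10\<close> by blast
    next
      case (2 t mem out)
      then show ?case using \<open>t1 \<le> _\<close> fin by simp
    qed
  qed
  then show ?thesis using m_gt by (simp add: store_junctions_def numeral_3_eq_3)
qed

lemma print_junctions_correct:
  fixes n :: nat and es ps :: "(nat \<times> nat) list"
  assumes inst: "is_instance G n es ps"
  defines "m \<equiv> length es" and "k \<equiv> length ps"
  shows "\<exists>t c. exec ((n + m + k + 2) ^ 7) (17 * (m + 1)) (input n es ps) print_junctions initial t c \<and>
    t \<le> 2100 * (n * (m + k) + 1) \<and> prints_junctions G ps c"
proof -
  let ?W = "(n + m + k + 2) ^ 7" and ?S = "17 * (m + 1)"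
  have "ram.wp ?W ?S (input n es ps) print_junctions (\<lambda>_. 0) [] 0
      (\<lambda>t mem out. t \<le> 2100 * (n * (m + k) + 1) \<and> prints_junctions G ps (mem, out))"
  proof (cases "es = []")
    case True
    have "{(i, s). i < length ps \<and> s \<in> junctions_of G (ps ! i)} = {}"
      using junctions_of_arcless[of G n ps] inst True by auto
    then have "prints_junctions G ps (\<lambda>_. 0, [])"
      unfolding prints_junctions_def by (intro exI[of _ "[]"]) (simp add: flatten_def)
    then show ?thesis
      using fits_Mv(1)[of n es ps ?S "\<lambda>_. 0"] fits_Mv(2)[of n es ps "\<lambda>_. 0"] True
      by (simp add: print_junctions_def ram.wp_If ram.wp_Skip m_def k_def)
  next
    case False
    show ?thesis
      unfolding m_def k_def
      by (rule instance_ram.wp_print_junctions[OF instance_ramI[OF inst False]]) simp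
  qed
  then show ?thesis
    unfolding ram.wp_def initial_def by fastforce
qed

lemma store_junctions_correct:
  fixes n :: nat and es ps :: "(nat \<times> nat) list"
  assumes inst: "is_instance G n es ps"
  defines "m \<equiv> length es" and "k \<equiv> length ps"
  shows "\<exists>t c. exec ((n + m + k + 2) ^ 7) (20 * (n * k + m + 1)) (input n es ps) store_junctions initial t c \<and>
    t \<le> 2200 * (n * (m + k) + 1) \<and> stores_junctions (20 * (n * k + m + 1)) G ps c"
proof -
  let ?W = "(n + m + k + 2) ^ 7" and ?S = "20 * (n * k + m + 1)"
  define p where "p = n * k"
  \<comment> \<open>The table's \<open>2 * k\<close> words must fit into a multiple of
    \<open>n * k + m + 1\<close>: a given pair consists of vertices, so \<open>n\<close> is positive
    once \<open>k\<close> is.\<close>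
  have "k \<le> p"
  proof (cases "ps = []")
    case False
    then have "hd ps \<in> pverts G \<times> pverts G"
      using inst hd_in_set[of ps] unfolding is_instance_def by blast
    then have "0 < n" using inst by (auto simp: is_instance_def)
    then show ?thesis by (simp add: p_def)
  qed (simp add: k_def)
  then have space: "17 + 14 * m + 2 * k + n * k \<le> ?S" unfolding p_def[symmetric] by simp
  have "ram.wp ?W ?S (input n es ps) store_junctions (\<lambda>_. 0) [] 0
      (\<lambda>t mem out. t \<le> 2200 * (n * (m + k) + 1) \<and> stores_junctions ?S G ps (mem, out))"
  proof (cases "es = []")
    case True
    have "junctions_of G q = {}" for q
      using junctions_of_arcless[of G n ps] inst True by auto
    moreover have "2 * length ps \<le> ?S" using space unfolding k_def by linarith
    \<comment> \<open>The all-zero memory already is a valid table at address 0, with every array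
      starting at 0 and having length 0.\<close>
    ultimately have "stores_junctions ?S G ps (\<lambda>_. 0, [])"
      by (simp add: stores_junctions_def)
    then show ?thesis
      using fits_Mv(1)[of n es ps ?S "\<lambda>_. 0"] fits_Mv(2)[of n es ps "\<lambda>_. 0"] True
      by (simp add: store_junctions_def ram.wp_If ram.wp_Skip m_def k_def)
  next
    case False
    have "17 + 14 * m \<le> ?S" using space by linarith
    then have "instance_ram ?W ?S n es ps m k G"
      unfolding m_def k_def by (rule instance_ramI[OF inst False])
    then have "store_ram ?W ?S n es ps m k G"
      unfolding store_ram_def store_ram_axioms_def using space word_bound(2) by blast
    then show ?thesis by (rule store_ram.wp_store_junctions)
  qed
  then show ?thesis
    unfolding ram.wp_def initial_def by fastforce
qed

text \<open>The word limit is polynomial in the size of the instance, so words have logarithmically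
  many bits. The \<open>+ 1\<close> in the time is for instances with
  \<open>n * (m + k) = 0\<close>, where a run still takes some steps.\<close>

theorem mainTheorem2:
  shows
    "(\<exists>P cT cS w. \<forall>G n m k es ps.
        is_instance G n es ps \<and> m = length es \<and> k = length ps \<longrightarrow>
        (\<exists>t c. exec ((n + m + k + 2) ^ w) (cS * (m + 1)) (input n es ps) P initial t c \<and>
               t \<le> cT * (n * (m + k) + 1) \<and>
               prints_junctions G ps c))
     \<and>
     (\<exists>P cT cS w. \<forall>G n m k es ps.
        is_instance G n es ps \<and> m = length es \<and> k = length ps \<longrightarrow>
        (\<exists>t c. exec ((n + m + k + 2) ^ w) (cS * (n * k + m + 1)) (input n es ps) P initial t c \<and>
               t \<le> cT * (n * (m + k) + 1) \<and>
               stores_junctions (cS * (n * k + m + 1)) G ps c))"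
proof (rule conjI, goal_cases)
  case 1
  show ?case
    by (rule exI[of _ print_junctions], rule exI[of _ 2100], rule exI[of _ 17], rule exI[of _ 7])
      (use print_junctions_correct in blast)
next
  case 2
  show ?case
    by (rule exI[of _ store_junctions], rule exI[of _ 2200], rule exI[of _ 20], rule exI[of _ 7])
      (use store_junctions_correct in blast)
qed

end
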